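(* There exist absolute constants $C_1, C_2>0$ such that the following holds. Let $0<\delta<1$. Then there is $n_0(\delta)$ such that for every $n\geq n_0(\delta)$ and every $A_n\subseteq\mathcal{P}_n$ with $|A_n|\geq\delta|\mathcal{P}_n|$, $$|A_n+A_n|\geq C_1\delta\, e^{-C_2(\log(1/\delta))^{2/3}(\log\log(1/\delta))^{1/3}}\, n.$$
   Context: $\mathcal{P}_n$ denotes the set of primes less than or equal to $n$. $A_n+A_n=\{a+a' : a,a'\in A_n\}$ is a set of integers. *)

theory Defs
  imports Complex_Main "HOL-Computational_Algebra.Primes" "HOL-Library.Set_Algebras"
begin

definition primes_upto :: "nat \<Rightarrow> nat set" where
  "primes_upto n = {p. prime p \<and> p \<le> n}"

(* The theorem uses the sumset A + A of Set_Algebras. For \<delta> > exp (-1) the iterated logarithm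
   ln (ln (1 / \<delta>)) is negative, so its power 1/3 is rendered as root 3, the real (odd) cube
   root, and not by powr, which is not meaningful on negative bases. *)

end

theory Submission
  imports Defs "HOL-Analysis.Analysis" "HOL-Real_Asymp.Real_Asymp" "HOL-Number_Theory.Cong"
begin

text \<open>
  Let \<open>r(m)\<close> count the \<open>a \<in> A\<close> for which \<open>m - a\<close> is a prime at most \<open>n\<close>. Then \<open>|A|\<^sup>2\<close> is at most the
  sum of \<open>r\<close> over \<open>A + A\<close>, so by the power mean inequality \<open>|A|\<close> to the power \<open>2k\<close> is at most
  \<open>|A + A|\<close> to the power \<open>k - 1\<close> times the \<open>k\<close>-th moment of \<open>r\<close>. That moment counts the pairs of a
  \<open>k\<close>-tuple \<open>a\<close> in \<open>A\<close> and an \<open>m\<close> such that all \<open>m - a i\<close> are prime, and a sieve of dimension \<open>k\<close>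
  bounds it, up to a factor polynomial in \<open>k\<close> per coordinate, by \<open>n (|A| / ln n)\<^sup>k\<close>. The only
  dependence on the tuple is through the primes dividing some \<open>a i - a j\<close>. Those up to \<open>2\<close>
  to the power \<open>O(k\<^sup>3)\<close> cost a power of \<open>k\<close>, and the larger ones are harmless on average. Since the bound for
  the moment contains \<open>|A|\<^sup>k\<close> and not just the \<open>k\<close>-th power of the number of primes, one obtains
  \<open>|A + A|\<close> at least of order \<open>\<delta>\<close> to the power \<open>k / (k - 1)\<close>, times \<open>n\<close>, up to powers of \<open>k\<close>. Taking
  \<open>k\<close> about \<open>ln (1 / \<delta>)\<close> gives \<open>\<delta> n\<close> up to a power of \<open>ln (1 / \<delta>)\<close>, which is stronger than needed.
\<close>

section \<open>The Selberg sieve\<close>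

text \<open>For a single tuple the product over collision primes has no bound independent of
  \<open>n\<close>, since a tuple may have of order \<open>k ^ 2 * ln n\<close> such primes. It is
  therefore bounded on average only, although it enters to the power \<open>k\<close>. Jensen's
  inequality makes this power linear in the primes, provided that weights of size
  \<open>4 * k / (p * ln p)\<close>, summed over \<open>k ^ 2\<close> pairs and all primes beyond
  \<open>2 ^ J\<close>, have mass at most 1. That tail is O(1 / \<open>J\<close>), whence
  \<open>J\<close> of order \<open>k ^ 3\<close>; the primes up to \<open>2 ^ J\<close> are given up
  at the price of a power of \<open>J\<close> per coordinate. Equidistribution of \<open>A\<close>
  modulo \<open>p\<close> is available only through an upper bound for all primes, which loses a
  factor 1 / \<delta>. The average over tuples saves \<open>sqrt (2 ^ J)\<close>, and this covers
  the loss because \<open>k\<close> is at least ln (1 / \<delta>). The sieve error is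
  \<open>x ^ (6 * k)\<close>, so \<open>x\<close> is a power of \<open>n\<close> with exponent of
  order 1 / \<open>k\<close>; this costs another factor of order \<open>k\<close> per coordinate.
  Finally \<open>k - 1 \<ge> ln (1 / \<delta>)\<close> turns the exponent \<open>k / (k - 1)\<close>
  of \<delta> into 1 at the cost of a factor e.\<close>

lemma prod_primes_pos:
  assumes "\<And>p. p \<in> S \<Longrightarrow> prime (p :: nat)"
  shows "\<Prod>S > 0"
  using assms by (intro prod_pos) (simp add: prime_gt_0_nat)

text \<open>Chinese remainder theorem: \<open>m\<close> runs through all pairs of residues exactly
  once. Injectivity comes from the congruences, surjectivity from counting.\<close>

lemma sum_mod_coprime:
  fixes F G :: "nat \<Rightarrow> real"
  assumes ab: "coprime a b" and pos: "a > 0" "b > 0"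
  shows "(\<Sum>m<a * b. F (m mod a) * G (m mod b)) = (\<Sum>m<a. F m) * (\<Sum>m<b. G m)"
proof -
  let ?f = "\<lambda>m. (m mod a, m mod b)"
  have inj: "inj_on ?f {..<a * b}"
  proof (rule inj_onI)
    fix x y assume x: "x \<in> {..<a * b}" and y: "y \<in> {..<a * b}" and e: "?f x = ?f y"
    have "[x = y] (mod a)" "[x = y] (mod b)"
      using e by (auto simp: cong_def)
    hence "[x = y] (mod (a * b))"
      using ab coprime_cong_mult_nat by blast
    thus "x = y" using x y by (auto simp: cong_def)
  qed
  have "?f ` {..<a * b} = {..<a} \<times> {..<b}"
  proof (rule card_subset_eq)
    show "card (?f ` {..<a * b}) = card ({..<a} \<times> {..<b})"
      using card_image[OF inj] by (simp add: card_cartesian_product)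
  qed (use pos in auto)
  hence "(\<Sum>x\<in>{..<a} \<times> {..<b}. F (fst x) * G (snd x)) = (\<Sum>m<a * b. F (m mod a) * G (m mod b))"
    using sum.reindex[OF inj, of "\<lambda>x. F (fst x) * G (snd x)"] by simp
  moreover have "(\<Sum>x\<in>{..<a} \<times> {..<b}. F (fst x) * G (snd x)) = (\<Sum>m<a. F m) * (\<Sum>m<b. G m)"
    by (simp add: sum_product sum.cartesian_product case_prod_beta)
  ultimately show ?thesis by simp
qed

lemma sum_prod_mod_primes:
  fixes g :: "nat \<Rightarrow> nat \<Rightarrow> real"
  assumes "finite S" "\<And>p. p \<in> S \<Longrightarrow> prime p"
  shows "(\<Sum>m<\<Prod>S. \<Prod>p\<in>S. g p (m mod p)) = (\<Prod>p\<in>S. \<Sum>r<p. g p r)"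
  using assms
proof (induction S rule: finite_induct)
  case (insert p S)
  define q where "q = \<Prod>S"
  have dv: "s dvd q" if "s \<in> S" for s
    unfolding q_def using insert.hyps that dvd_prodI[of S s "\<lambda>x. x"] by simp
  have qpos: "q > 0" unfolding q_def using insert.prems by (intro prod_primes_pos) auto
  have cop: "coprime p q"
    unfolding q_def using insert by (auto intro!: prod_coprime_right primes_coprime)
  have "(\<Sum>m<\<Prod>(insert p S). \<Prod>s\<in>insert p S. g s (m mod s))
      = (\<Sum>m<p * q. g p (m mod p) * (\<Prod>s\<in>S. g s (m mod q mod s)))"
    using insert.hyps dv by (auto simp: q_def[symmetric] mod_mod_cancel intro!: sum.cong prod.cong)
  also have "\<dots> = (\<Sum>r<p. g p r) * (\<Sum>m<q. \<Prod>s\<in>S. g s (m mod s))"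
    using sum_mod_coprime[OF cop, of "g p" "\<lambda>m. \<Prod>s\<in>S. g s (m mod s)"] qpos insert.prems
    by (auto simp: prime_gt_0_nat)
  finally show ?case using insert by (simp add: q_def)
qed simp

text \<open>Complete periods contribute exactly \<open>q * \<mu>\<close> each; the incomplete one
  has fewer than \<open>q\<close> terms, each at most \<open>B\<close>. As \<open>\<mu>\<close> is
  nonnegative, the length covered by complete periods may be rounded up to \<open>N\<close>.\<close>

lemma sum_periodic_le:
  fixes H :: "nat \<Rightarrow> real"
  assumes per: "\<And>m. H (m mod q) = H m" and q: "q > 0" and bd: "\<And>m. \<bar>H m\<bar> \<le> B"
    and mean: "(\<Sum>m<q. H m) = real q * \<mu>" and mu: "\<mu> \<ge> 0"
  shows "(\<Sum>m<N. H m) \<le> real N * \<mu> + real q * B"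
proof -
  have shift: "H (j * q + m) = H m" for j m
    using per[of "j * q + m"] per[of m] by simp
  have split: "(\<Sum>m<a + b. H m) = (\<Sum>m<a. H m) + (\<Sum>m<b. H (a + m))" for a b
    by (induction b) (auto simp: algebra_simps)
  have full: "(\<Sum>m<j * q. H m) = real j * (real q * \<mu>)" for j
  proof (induction j)
    case (Suc j)
    have "(\<Sum>m<Suc j * q. H m) = (\<Sum>m<j * q. H m) + (\<Sum>m<q. H (j * q + m))"
      using split[of "j * q" q] by (simp add: add.commute)
    also have "\<dots> = real j * (real q * \<mu>) + real q * \<mu>" unfolding shift Suc mean ..
    finally show ?case by (simp add: algebra_simps)
  qed simp
  define j r where "j = N div q" and "r = N mod q"
  have N: "N = j * q + r" by (simp add: j_def r_def)
  have r: "r < q" using q by (simp add: r_def)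
  have "(\<Sum>m<N. H m) = (\<Sum>m<j * q. H m) + (\<Sum>m<r. H (j * q + m))"
    unfolding N by (rule split)
  also have "\<dots> = real j * (real q * \<mu>) + (\<Sum>m<r. H m)" by (simp add: full shift)
  also have "(\<Sum>m<r. H m) \<le> (\<Sum>m<r. B)"
    by (intro sum_mono) (use bd abs_le_D1 in blast)
  also have "\<dots> \<le> real q * B"
    using r bd[of 0] by (simp add: mult_right_mono)
  also have "real j * (real q * \<mu>) \<le> real N * \<mu>"
    using mu by (simp add: N mult_right_mono algebra_simps)
  finally show ?thesis by simp
qed

lemma prod_primes_inj:
  assumes "finite S" "finite S'" "\<And>p. p \<in> S \<Longrightarrow> prime p" "\<And>p. p \<in> S' \<Longrightarrow> prime p"
    and eq: "\<Prod>S = (\<Prod>S' :: nat)"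
  shows "S = S'"
proof -
  have *: "p \<in> T \<longleftrightarrow> p dvd \<Prod>T" if "finite T" "\<And>p. p \<in> T \<Longrightarrow> prime p" "prime p" for p :: nat and T
    using that prime_dvd_prod_iff[of T p "\<lambda>x. x"] primes_dvd_imp_eq dvd_refl by blast
  show ?thesis
  proof (rule Set.set_eqI)
    show "p \<in> S \<longleftrightarrow> p \<in> S'" for p
      using *[of S p] *[of S' p] assms by (cases "prime p") auto
  qed
qed

text \<open>A set of primes stands for the squarefree number that is its product. Distinct sets give
  distinct numbers in \<open>{1..Q}\<close>.\<close>

lemma card_sets_prod_le:
  assumes "finite PP" "\<And>p. p \<in> PP \<Longrightarrow> prime (p :: nat)"
  shows "card {S. S \<subseteq> PP \<and> \<Prod>S \<le> Q} \<le> Q"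
proof -
  let ?F = "{S. S \<subseteq> PP \<and> \<Prod>S \<le> Q}"
  have "inj_on (\<lambda>S. \<Prod>S) ?F"
    by (rule inj_onI, rule prod_primes_inj) (use assms finite_subset in blast)+
  moreover have "(\<lambda>S. \<Prod>S) ` ?F \<subseteq> {1..Q}"
    using assms prod_primes_pos by (auto simp: Suc_le_eq subset_iff)
  ultimately have "card ?F \<le> card {1..Q}"
    by (meson card_inj_on_le finite_atLeastAtMost)
  thus ?thesis by simp
qed

text \<open>Selberg's sieve, run as an orthogonality argument. The function \<open>\<psi> p\<close> below has mean zero
  modulo \<open>p\<close> and equals \<open>1\<close> off \<open>\<Omega> p\<close>. Its products \<open>\<phi> S\<close> over different sets of primes are nearly
  orthogonal on an interval, and all of them equal \<open>1\<close> on \<open>M\<close>.\<close>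

lemma sieve_second_moment:
  fixes \<Omega> :: "nat \<Rightarrow> nat set" and Q N k :: nat and M PP :: "nat set"
  assumes fin: "finite PP" and pr: "\<And>p. p \<in> PP \<Longrightarrow> prime p"
    and k: "k \<ge> 1" and pk: "\<And>p. p \<in> PP \<Longrightarrow> 2 * k \<le> p"
    and om: "\<And>p. p \<in> PP \<Longrightarrow> \<Omega> p \<subseteq> {..<p}" "\<And>p. p \<in> PP \<Longrightarrow> card (\<Omega> p) = k"
    and M: "M \<subseteq> {..<N}" "\<And>m p. m \<in> M \<Longrightarrow> p \<in> PP \<Longrightarrow> m mod p \<notin> \<Omega> p"
  defines "L \<equiv> \<Sum>S | S \<subseteq> PP \<and> \<Prod>S \<le> Q. \<Prod>p\<in>S. real k / (real p - real k)"
  shows "real (card M) * L\<^sup>2 \<le> real N * L + real Q ^ 6"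
proof -
  define F where "F = {S. S \<subseteq> PP \<and> \<Prod>S \<le> Q}"
  define h where "h = (\<lambda>S. \<Prod>p\<in>S. real k / (real p - real k))"
  \<comment> \<open>The value on \<open>\<Omega> p\<close> is forced by mean zero. The mean square
    modulo \<open>p\<close> then is \<open>(p - k) / k\<close>, the reciprocal of the factor of
    \<open>h\<close> at \<open>p\<close>, so \<open>\<phi> S\<close> has mean square
    \<open>1 / h S\<close>.\<close>
  define \<psi> where "\<psi> = (\<lambda>p r. if r \<in> \<Omega> p then - (real p - real k) / real k else 1)"
  define \<phi> where "\<phi> = (\<lambda>S m. \<Prod>p\<in>S. \<psi> p (m mod p))"
  have finF: "finite F" unfolding F_def using fin by simp
  have SF: "finite S" "\<And>p. p \<in> S \<Longrightarrow> p \<in> PP" if "S \<in> F" for S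
    using that fin finite_subset by (auto simp: F_def)
  have pk': "real p \<ge> 2 * real k" if "p \<in> PP" for p using pk[OF that] by linarith
  have k0: "real k > 0" using k by simp
  have hh: "0 \<le> h S" "h S \<le> 1" if "S \<in> F" for S
  proof -
    have "0 \<le> real k / (real p - real k) \<and> real k / (real p - real k) \<le> 1" if "p \<in> S" for p
      using pk'[of p] SF(2)[OF \<open>S \<in> F\<close> that] k0 by (simp add: divide_simps)
    thus "0 \<le> h S" "h S \<le> 1" unfolding h_def by (auto intro!: prod_nonneg prod_le_1)
  qed
  have sum1: "(\<Sum>r<p. \<psi> p r) = 0" and sum2: "(\<Sum>r<p. (\<psi> p r)\<^sup>2) = real p * ((real p - real k) / real k)"
    if p: "p \<in> PP" for p
  proof -
    have split: "(\<Sum>r<p. G (\<psi> p r)) = real k * G (- (real p - real k) / real k) + (real p - real k) * G 1"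
      for G :: "real \<Rightarrow> real"
    proof -
      have c: "real (card ({..<p} - \<Omega> p)) = real p - real k"
        using om[OF p] pk[OF p] by (subst card_Diff_subset) (auto simp: finite_subset)
      have "(\<Sum>r<p. G (\<psi> p r)) = (\<Sum>r\<in>\<Omega> p. G (\<psi> p r)) + (\<Sum>r\<in>{..<p} - \<Omega> p. G (\<psi> p r))"
        using om(1)[OF p] by (subst sum.subset_diff[of "\<Omega> p"]) auto
      also have "(\<Sum>r\<in>\<Omega> p. G (\<psi> p r)) = real k * G (- (real p - real k) / real k)"
        using om(2)[OF p] by (simp add: \<psi>_def)
      also have "(\<Sum>r\<in>{..<p} - \<Omega> p. G (\<psi> p r)) = (\<Sum>r\<in>{..<p} - \<Omega> p. G 1)"
        by (intro sum.cong) (auto simp: \<psi>_def)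
      also have "\<dots> = (real p - real k) * G 1" using c by simp
      finally show ?thesis .
    qed
    show "(\<Sum>r<p. \<psi> p r) = 0" using split[of "\<lambda>x. x"] k0 by simp
    show "(\<Sum>r<p. (\<psi> p r)\<^sup>2) = real p * ((real p - real k) / real k)"
    proof -
      have "(\<Sum>r<p. (\<psi> p r)\<^sup>2)
          = real k * (- (real p - real k) / real k)\<^sup>2 + (real p - real k)"
        using split[of "\<lambda>x. x\<^sup>2"] by simp
      also have "\<dots> = (real p - real k)\<^sup>2 / real k + (real p - real k)"
        using k0 by (simp add: power2_eq_square field_simps)
      also have "\<dots> = real p * ((real p - real k) / real k)"
        using k0 by (simp add: divide_simps power2_eq_square) (simp add: algebra_simps)
      finally show ?thesis .
    qed
  qed
  have psib: "\<bar>\<psi> p r\<bar> \<le> real p" if "p \<in> PP" for p r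
  proof -
    have "real p - real k \<le> real p * real k"
      using k0 k pk'[OF that] by (metis diff_le_eq le_add_same_cancel1 mult_left_mono mult.right_neutral
        of_nat_0_le_iff of_nat_1 of_nat_le_iff order_trans)
    thus ?thesis using pk'[OF that] k0 k by (auto simp: \<psi>_def abs_if field_simps)
  qed
  have phib: "\<bar>\<phi> S m\<bar> \<le> real Q" if "S \<in> F" for S m
  proof -
    have "\<bar>\<phi> S m\<bar> \<le> (\<Prod>p\<in>S. real p)"
      unfolding \<phi>_def abs_prod using psib SF(2)[OF that] by (intro prod_mono) auto
    also have "\<dots> \<le> real Q"
      using that by (auto simp: F_def simp flip: of_nat_prod)
    finally show ?thesis .
  qed
  \<comment> \<open>If \<open>S\<close> and \<open>S'\<close> differ, a prime in exactly one of them
    contributes a factor with mean zero. The product has a period of at most \<open>Q ^ 2\<close>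
    and is bounded by \<open>Q ^ 2\<close>, which gives the error \<open>Q ^ 4\<close>.\<close>
  have corr: "(\<Sum>m<N. \<phi> S m * \<phi> S' m) \<le> (if S = S' then real N / h S else 0) + real Q ^ 4"
    if S: "S \<in> F" and S': "S' \<in> F" for S S'
  proof -
    define U where "U = S \<union> S'"
    define g where "g = (\<lambda>p r. (if p \<in> S then \<psi> p r else 1) * (if p \<in> S' then \<psi> p r else 1))"
    have finU: "finite U" and UP: "\<And>p. p \<in> U \<Longrightarrow> p \<in> PP"
      unfolding U_def using SF[OF S] SF[OF S'] by auto
    have eq: "\<phi> S m * \<phi> S' m = (\<Prod>p\<in>U. g p (m mod p))" for m
    proof -
      have 1: "(\<Prod>p\<in>U. if p \<in> S then \<psi> p (m mod p) else 1) = \<phi> S m"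
        unfolding \<phi>_def using finU by (intro prod.mono_neutral_cong_right) (auto simp: U_def)
      have 2: "(\<Prod>p\<in>U. if p \<in> S' then \<psi> p (m mod p) else 1) = \<phi> S' m"
        unfolding \<phi>_def using finU by (intro prod.mono_neutral_cong_right) (auto simp: U_def)
      show ?thesis unfolding g_def prod.distrib 1 2 ..
    qed
    define q where "q = \<Prod>U"
    have q0: "q > 0" unfolding q_def using UP pr by (intro prod_primes_pos) auto
    have dv: "p dvd q" if "p \<in> U" for p unfolding q_def using that finU dvd_prodI[of U p "\<lambda>x. x"] by simp
    have "q * \<Prod>(S \<inter> S') = \<Prod>S * \<Prod>S'"
      unfolding q_def U_def using SF[OF S] SF[OF S'] by (simp add: prod.union_inter)
    moreover have "\<Prod>(S \<inter> S') > 0"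
      using SF(2)[OF S] pr by (intro prod_primes_pos) auto
    ultimately have "q \<le> \<Prod>S * \<Prod>S'"
      by (metis Suc_leI mult.right_neutral mult_le_mono2 One_nat_def)
    also have "\<dots> \<le> Q * Q" using S S' by (intro mult_mono) (auto simp: F_def)
    finally have qQ: "real q \<le> real Q ^ 2"
      by (metis of_nat_le_iff of_nat_mult power2_eq_square)
    define \<mu> where "\<mu> = (if S = S' then 1 / h S else 0)"
    have mean: "(\<Sum>m<q. \<phi> S m * \<phi> S' m) = real q * \<mu>"
    proof -
      have *: "(\<Sum>m<q. \<phi> S m * \<phi> S' m) = (\<Prod>p\<in>U. \<Sum>r<p. g p r)"
        unfolding eq q_def using finU UP pr by (intro sum_prod_mod_primes) auto
      show ?thesis
      proof (cases "S = S'")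
        case True
        have "(\<Prod>p\<in>U. \<Sum>r<p. g p r) = (\<Prod>p\<in>U. real p * ((real p - real k) / real k))"
          using True sum2 UP by (intro prod.cong) (auto simp: g_def U_def power2_eq_square)
        also have "\<dots> = real q * \<mu>"
          using True by (simp add: q_def \<mu>_def h_def U_def prod.distrib prod_dividef)
        finally show ?thesis using * by simp
      next
        case False
        then obtain p where p: "p \<in> U" "p \<in> S \<longleftrightarrow> p \<notin> S'" by (auto simp: U_def)
        have "(\<Sum>r<p. g p r) = (\<Sum>r<p. \<psi> p r)"
          using p by (auto simp: g_def U_def intro!: sum.cong)
        also have "\<dots> = 0" using sum1 UP p by simp
        finally have "(\<Prod>p\<in>U. \<Sum>r<p. g p r) = 0"
          using finU p by (auto intro!: prod_zero)
        thus ?thesis using * False by (simp add: \<mu>_def)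
      qed
    qed
    have "(\<Sum>m<N. \<phi> S m * \<phi> S' m) \<le> real N * \<mu> + real q * (real Q * real Q)"
    proof (rule sum_periodic_le[OF _ q0 _ mean])
      show "\<phi> S (m mod q) * \<phi> S' (m mod q) = \<phi> S m * \<phi> S' m" for m
        unfolding eq using dv by (intro prod.cong) (auto simp: mod_mod_cancel)
      show "\<bar>\<phi> S m * \<phi> S' m\<bar> \<le> real Q * real Q" for m
        unfolding abs_mult using phib[OF S] phib[OF S'] by (intro mult_mono) auto
      show "\<mu> \<ge> 0" unfolding \<mu>_def using hh(1)[OF S] by (cases "S = S'") auto
    qed
    moreover have "real q * (real Q * real Q) \<le> real Q ^ 2 * (real Q * real Q)"
      using qQ by (intro mult_right_mono) auto
    moreover have "real N * \<mu> = (if S = S' then real N / h S else 0)" by (simp add: \<mu>_def)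
    ultimately show ?thesis by (simp add: power4_eq_xxxx power2_eq_square mult.assoc)
  qed
  \<comment> \<open>The coefficients \<open>h S\<close> make the diagonal
    \<open>N * (h S)\<^sup>2 / h S\<close> sum to \<open>N * L\<close>, while \<open>T\<close>
    equals \<open>L\<close> on \<open>M\<close>. By Cauchy-Schwarz they minimise the diagonal for a
    prescribed value on \<open>M\<close>.\<close>
  define T where "T = (\<lambda>m. \<Sum>S\<in>F. h S * \<phi> S m)"
  have L: "L = sum h F" by (simp add: L_def F_def h_def)
  have TM: "T m = L" if "m \<in> M" for m
  proof -
    have "\<phi> S m = 1" if "S \<in> F" for S
      unfolding \<phi>_def using M(2)[OF \<open>m \<in> M\<close>] SF(2)[OF that] by (intro prod.neutral) (auto simp: \<psi>_def)
    thus ?thesis by (simp add: T_def L)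
  qed
  have "real (card M) * L\<^sup>2 = (\<Sum>m\<in>M. (T m)\<^sup>2)" using TM by simp
  also have "\<dots> \<le> (\<Sum>m<N. (T m)\<^sup>2)" using M(1) by (intro sum_mono2) auto
  also have "\<dots> = (\<Sum>m<N. \<Sum>S\<in>F. \<Sum>S'\<in>F. h S * h S' * (\<phi> S m * \<phi> S' m))"
    by (simp add: T_def power2_eq_square sum_product mult_ac)
  also have "\<dots> = (\<Sum>S\<in>F. \<Sum>S'\<in>F. \<Sum>m<N. h S * h S' * (\<phi> S m * \<phi> S' m))"
    by (subst sum.swap, intro sum.cong refl, rule sum.swap)
  also have "\<dots> = (\<Sum>S\<in>F. \<Sum>S'\<in>F. h S * h S' * (\<Sum>m<N. \<phi> S m * \<phi> S' m))"
    by (simp add: sum_distrib_left)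
  also have "\<dots> \<le> (\<Sum>S\<in>F. \<Sum>S'\<in>F. (if S = S' then real N * h S else 0) + real Q ^ 4)"
  proof (intro sum_mono)
    fix S S' assume S: "S \<in> F" and S': "S' \<in> F"
    have "h S * h S' * (\<Sum>m<N. \<phi> S m * \<phi> S' m)
        \<le> h S * h S' * ((if S = S' then real N / h S else 0) + real Q ^ 4)"
      using hh[OF S] hh[OF S'] corr[OF S S'] by (intro mult_left_mono) auto
    also have "\<dots> = h S * h S' * (if S = S' then real N / h S else 0) + h S * h S' * real Q ^ 4"
      by (simp add: algebra_simps)
    also have "h S * h S' * real Q ^ 4 \<le> real Q ^ 4"
      using hh[OF S] hh[OF S'] by (intro mult_left_le_one_le) (auto intro: mult_le_one)
    also have "h S * h S' * (if S = S' then real N / h S else 0) = (if S = S' then real N * h S else 0)"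
      by simp
    finally show "h S * h S' * (\<Sum>m<N. \<phi> S m * \<phi> S' m)
       \<le> (if S = S' then real N * h S else 0) + real Q ^ 4" by simp
  qed
  also have "\<dots> = real N * L + real (card F) * (real (card F) * real Q ^ 4)"
    using finF by (simp add: sum.distrib L sum_distrib_left)
  \<comment> \<open>There are at most \<open>Q ^ 2\<close> pairs of sets, each with error at most
    \<open>Q ^ 4\<close>.\<close>
  also have "real (card F) * (real (card F) * real Q ^ 4) \<le> real Q * (real Q * real Q ^ 4)"
    using card_sets_prod_le[OF fin pr, of Q] by (intro mult_mono) (auto simp: F_def)
  finally show ?thesis by (simp add: power_numeral_reduce algebra_simps)
qed

section \<open>Lower bounds for the main term of the sieve\<close>

text \<open>The sum over squarefree numbers up to \<open>x\<close> with prime factors in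
  \<open>PP\<close> of the multiplicative function with values \<open>g\<close> at primes. Coding
  the numbers as sets of primes turns each identity into an induction on \<open>PP\<close>.\<close>

definition sqfree_sum :: "(nat \<Rightarrow> real) \<Rightarrow> nat \<Rightarrow> nat set \<Rightarrow> real" where
  "sqfree_sum g x PP = (\<Sum>S | S \<subseteq> PP \<and> \<Prod>S \<le> x. \<Prod>p\<in>S. g p)"

lemma sqfree_sum_empty: "sqfree_sum g x {} = (if x \<ge> 1 then 1 else 0)"
proof -
  have "{S::nat set. S \<subseteq> {} \<and> \<Prod>S \<le> x} = (if x \<ge> 1 then {{}} else {})" by auto
  thus ?thesis by (simp add: sqfree_sum_def)
qed

lemma sqfree_sum_nonneg:
  assumes "\<And>p. p \<in> PP \<Longrightarrow> g p \<ge> 0"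
  shows "sqfree_sum g x PP \<ge> 0"
  unfolding sqfree_sum_def using assms by (intro sum_nonneg prod_nonneg) auto

lemma sqfree_sum_mono:
  assumes "finite PP" "\<And>p. p \<in> PP \<Longrightarrow> 0 \<le> g p" "\<And>p. p \<in> PP \<Longrightarrow> g p \<le> h p" "x \<le> y"
  shows "sqfree_sum g x PP \<le> sqfree_sum h y PP"
proof -
  have "sqfree_sum g x PP \<le> sqfree_sum h x PP"
    unfolding sqfree_sum_def using assms by (intro sum_mono prod_mono) auto
  also have "\<dots> \<le> sqfree_sum h y PP"
    unfolding sqfree_sum_def
  proof (rule sum_mono2)
    fix S assume S: "S \<in> {S. S \<subseteq> PP \<and> \<Prod>S \<le> y} - {S. S \<subseteq> PP \<and> \<Prod>S \<le> x}"
    have "0 \<le> h p" if "p \<in> S" for p using S that assms(2,3)[of p] by auto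
    thus "0 \<le> prod h S" by (intro prod_nonneg) auto
  qed (use assms in auto)
  finally show ?thesis .
qed

text \<open>The recursion behind the inductions below. For integers,
  \<open>p * \<Prod>S \<le> x\<close> says exactly \<open>\<Prod>S \<le> x div p\<close>, so the
  floor loses nothing.\<close>

lemma sqfree_sum_insert:
  assumes fin: "finite PP" and p: "p \<notin> PP" "p > 0"
  shows "sqfree_sum g x (insert p PP) = sqfree_sum g x PP + g p * sqfree_sum g (x div p) PP"
proof -
  let ?A = "{S. S \<subseteq> PP \<and> \<Prod>S \<le> x}" and ?B = "{S. S \<subseteq> PP \<and> \<Prod>S \<le> x div p}"
  have finS: "finite S" "p \<notin> S" if "S \<subseteq> PP" for S
    using that fin p finite_subset by auto
  have pr: "\<Prod>(insert p S) = p * \<Prod>S" if "S \<subseteq> PP" for S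
    using finS[OF that] by simp
  have iff: "p * y \<le> x \<longleftrightarrow> y \<le> x div p" for y
    using p by (simp add: less_eq_div_iff_mult_less_eq mult.commute)
  have "{S. S \<subseteq> insert p PP \<and> \<Prod>S \<le> x} = ?A \<union> insert p ` ?B"
  proof (intro equalityI subsetI)
    fix S assume S: "S \<in> {S. S \<subseteq> insert p PP \<and> \<Prod>S \<le> x}"
    show "S \<in> ?A \<union> insert p ` ?B"
    proof (cases "p \<in> S")
      case True
      define S' where "S' = S - {p}"
      have "S' \<subseteq> PP" "S = insert p S'" using S True by (auto simp: S'_def)
      thus ?thesis using S pr[of S'] iff by auto
    next
      case False thus ?thesis using S by auto
    qed
  next
    fix S assume "S \<in> ?A \<union> insert p ` ?B"
    thus "S \<in> {S. S \<subseteq> insert p PP \<and> \<Prod>S \<le> x}" using pr iff by auto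
  qed
  moreover have "?A \<inter> insert p ` ?B = {}" using p by auto
  moreover have "inj_on (insert p) ?B"
    by (rule inj_onI) (use p in auto)
  moreover have "(\<Sum>S\<in>?B. prod g (insert p S)) = (\<Sum>S\<in>?B. g p * prod g S)"
    by (intro sum.cong) (use finS in auto)
  ultimately show ?thesis
    unfolding sqfree_sum_def using fin
    by (simp add: sum.union_disjoint sum.reindex sum_distrib_left)
qed

text \<open>Send a pair of sets to its union, whose product is at most \<open>x * y\<close>. Each
  prime of the union lies in the first set only, in the second only, or in both, which accounts for
  the three terms of the new weight.\<close>

lemma sqfree_sum_mult:
  assumes "finite PP" "\<And>p. p \<in> PP \<Longrightarrow> p > 0"
    and "\<And>p. p \<in> PP \<Longrightarrow> g p \<ge> 0" "\<And>p. p \<in> PP \<Longrightarrow> h p \<ge> 0"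
  shows "sqfree_sum g x PP * sqfree_sum h y PP \<le> sqfree_sum (\<lambda>p. g p + h p + g p * h p) (x * y) PP"
  using assms
proof (induction PP arbitrary: x y rule: finite_induct)
  case (insert p PP)
  let ?r = "\<lambda>p. g p + h p + g p * h p"
  note rec = sqfree_sum_insert[OF insert.hyps(1,2), of]
  have p: "p > 0" using insert.prems by simp
  have IH: "sqfree_sum g x PP * sqfree_sum h y PP \<le> sqfree_sum ?r z PP" if "x * y \<le> z" for x y z
  proof -
    have "sqfree_sum g x PP * sqfree_sum h y PP \<le> sqfree_sum ?r (x * y) PP"
      using insert.IH insert.prems by simp
    also have "\<dots> \<le> sqfree_sum ?r z PP"
      using insert that by (intro sqfree_sum_mono) auto
    finally show ?thesis .
  qed
  \<comment> \<open>A prime in both sets divides the product of the two numbers twice but occurs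
    once in the union, so dividing \<open>x * y\<close> by \<open>p\<close> once is enough in all
    three cases.\<close>
  have d1: "(x div p) * y \<le> x * y div p" and d2: "x * (y div p) \<le> x * y div p"
    and d3: "(x div p) * (y div p) \<le> x * y div p"
  proof -
    show d1: "(x div p) * y \<le> x * y div p"
      by (metis div_mult1_eq le_add1 mult.commute)
    show "x * (y div p) \<le> x * y div p" by (metis div_mult1_eq le_add1)
    have "(x div p) * (y div p) \<le> (x div p) * y" by (simp add: div_le_dividend)
    thus "(x div p) * (y div p) \<le> x * y div p" using d1 by linarith
  qed
  have g: "g p \<ge> 0" "h p \<ge> 0" using insert.prems by auto
  have "sqfree_sum g x (insert p PP) * sqfree_sum h y (insert p PP)
     = sqfree_sum g x PP * sqfree_sum h y PP + g p * (sqfree_sum g (x div p) PP * sqfree_sum h y PP)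
       + h p * (sqfree_sum g x PP * sqfree_sum h (y div p) PP)
       + g p * h p * (sqfree_sum g (x div p) PP * sqfree_sum h (y div p) PP)"
    using rec p by (simp add: algebra_simps)
  also have "\<dots> \<le> sqfree_sum ?r (x * y) PP + g p * sqfree_sum ?r (x * y div p) PP
       + h p * sqfree_sum ?r (x * y div p) PP + g p * h p * sqfree_sum ?r (x * y div p) PP"
    using g d1 d2 d3 by (intro add_mono mult_left_mono IH) auto
  also have "\<dots> = sqfree_sum ?r (x * y) (insert p PP)"
    using rec p by (simp add: algebra_simps)
  finally show ?case .
qed (auto simp: sqfree_sum_empty)

text \<open>The weight produced by a product satisfies \<open>1 + r = (1 + g) * (1 + h)\<close>, so
  iteration yields \<open>(1 + g) ^ k - 1\<close>. This compares a sieve of dimension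
  \<open>k\<close> with the \<open>k\<close>-th power of the one-dimensional sum.\<close>

lemma sqfree_sum_power:
  assumes "finite PP" "\<And>p. p \<in> PP \<Longrightarrow> p > 0" "\<And>p. p \<in> PP \<Longrightarrow> g p \<ge> 0"
  shows "sqfree_sum g x PP ^ k \<le> sqfree_sum (\<lambda>p. (1 + g p) ^ k - 1) (x ^ k) PP"
proof (induction k)
  case 0
  have "(\<Sum>S\<in>{{} :: nat set}. \<Prod>p\<in>S. (0::real)) \<le> sqfree_sum (\<lambda>p. 0) 1 PP"
    unfolding sqfree_sum_def using assms(1) by (intro sum_mono2) (auto intro: prod_nonneg)
  thus ?case by simp
next
  case (Suc k)
  have "sqfree_sum g x PP ^ Suc k \<le> sqfree_sum g x PP * sqfree_sum (\<lambda>p. (1 + g p) ^ k - 1) (x ^ k) PP"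
    using Suc sqfree_sum_nonneg[of PP g x] assms(3) by (simp add: mult_left_mono)
  also have "\<dots> \<le> sqfree_sum (\<lambda>p. g p + ((1 + g p) ^ k - 1) + g p * ((1 + g p) ^ k - 1)) (x * x ^ k) PP"
    using assms by (intro sqfree_sum_mult) auto
  also have "(\<lambda>p. g p + ((1 + g p) ^ k - 1) + g p * ((1 + g p) ^ k - 1)) = (\<lambda>p. (1 + g p) ^ Suc k - 1)"
    by (simp add: algebra_simps)
  finally show ?case by simp
qed

text \<open>Used backwards: it bounds from above what is lost when the primes of \<open>D\<close>
  are left out of the sieve.\<close>

lemma sqfree_sum_union_le:
  assumes "finite D" "finite PP" "\<And>p. p \<in> D \<union> PP \<Longrightarrow> p > 0" "\<And>p. p \<in> D \<union> PP \<Longrightarrow> g p \<ge> 0"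
  shows "sqfree_sum g x (D \<union> PP) \<le> (\<Prod>p\<in>D. 1 + g p) * sqfree_sum g x PP"
  using assms
proof (induction D rule: finite_induct)
  case (insert p D)
  show ?case
  proof (cases "p \<in> D \<union> PP")
    case True
    hence "sqfree_sum g x (insert p D \<union> PP) = sqfree_sum g x (D \<union> PP)" by (simp add: insert_absorb)
    also have "\<dots> \<le> 1 * ((\<Prod>p\<in>D. 1 + g p) * sqfree_sum g x PP)" using insert by simp
    also have "\<dots> \<le> (1 + g p) * ((\<Prod>p\<in>D. 1 + g p) * sqfree_sum g x PP)"
      using insert by (intro mult_right_mono mult_nonneg_nonneg prod_nonneg sqfree_sum_nonneg) auto
    finally show ?thesis using insert by (simp add: mult_ac)
  next
    case False
    have "sqfree_sum g x (insert p D \<union> PP)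
        = sqfree_sum g x (D \<union> PP) + g p * sqfree_sum g (x div p) (D \<union> PP)"
      using insert False by (simp add: sqfree_sum_insert)
    also have "\<dots> \<le> sqfree_sum g x (D \<union> PP) + g p * sqfree_sum g x (D \<union> PP)"
      using insert by (intro add_left_mono mult_left_mono sqfree_sum_mono) auto
    also have "\<dots> = (1 + g p) * sqfree_sum g x (D \<union> PP)" by (simp add: algebra_simps)
    also have "\<dots> \<le> (1 + g p) * ((\<Prod>p\<in>D. 1 + g p) * sqfree_sum g x PP)"
      using insert by (intro mult_left_mono) auto
    finally show ?thesis using insert by (simp add: mult_ac)
  qed
qed simp

definition smooth_sum :: "nat \<Rightarrow> nat set \<Rightarrow> real" where
  "smooth_sum x PP = (\<Sum>n | n \<in> {1..x} \<and> prime_factors n \<subseteq> PP. 1 / real n)"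

lemma smooth_sum_mono: "x \<le> y \<Longrightarrow> smooth_sum x PP \<le> smooth_sum y PP"
  unfolding smooth_sum_def by (intro sum_mono2) auto

lemma smooth_sum_insert:
  assumes p: "prime p" "p \<notin> PP"
  shows "smooth_sum x (insert p PP) = smooth_sum x PP + smooth_sum (x div p) (insert p PP) / real p"
proof -
  have p0: "p > 0" using p prime_gt_0_nat by blast
  let ?A = "{n. n \<in> {1..x} \<and> prime_factors n \<subseteq> PP}"
  let ?B = "{n. n \<in> {1..x div p} \<and> prime_factors n \<subseteq> insert p PP}"
  have iff: "p * y \<le> x \<longleftrightarrow> y \<le> x div p" for y
    using p0 by (simp add: less_eq_div_iff_mult_less_eq mult.commute)
  have pf: "prime_factors (p * n) = insert p (prime_factors n)" if "n > 0" for n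
    using that p p0 by (simp add: prime_factors_product prime_prime_factors)
  have "{n. n \<in> {1..x} \<and> prime_factors n \<subseteq> insert p PP} = ?A \<union> (*) p ` ?B"
  proof (intro equalityI subsetI)
    fix n assume n: "n \<in> {n. n \<in> {1..x} \<and> prime_factors n \<subseteq> insert p PP}"
    show "n \<in> ?A \<union> (*) p ` ?B"
    proof (cases "p dvd n")
      case True
      then obtain m where m: "n = p * m" by auto
      hence "m > 0" using n by (auto intro: Nat.gr0I)
      thus ?thesis using n m pf[of m] iff by auto
    next
      case False
      thus ?thesis using n by (auto simp: in_prime_factors_iff)
    qed
  next
    fix n assume "n \<in> ?A \<union> (*) p ` ?B"
    thus "n \<in> {n. n \<in> {1..x} \<and> prime_factors n \<subseteq> insert p PP}"
    proof
      assume "n \<in> (*) p ` ?B"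
      then obtain m where "n = p * m" "m \<in> ?B" by auto
      thus ?thesis using pf[of m] iff p0 by auto
    qed auto
  qed
  moreover have "?A \<inter> (*) p ` ?B = {}" using p pf by auto
  moreover have "inj_on ((*) p) ?B" using p0 by (auto intro: inj_onI)
  ultimately show ?thesis
    unfolding smooth_sum_def
    by (simp add: sum.union_disjoint sum.reindex sum_divide_distrib) (simp add: mult.commute)
qed

text \<open>The powers of \<open>p\<close> dividing \<open>n\<close> contribute the geometric series
  \<open>1 / p + 1 / p ^ 2 + ... = 1 / (p - 1)\<close>. It is summed by induction on
  \<open>x\<close>, as the recursion keeps \<open>p\<close> on its right-hand side.\<close>

lemma smooth_sum_insert_le:
  assumes p: "prime p" "p \<notin> PP"
  shows "smooth_sum x (insert p PP) \<le> smooth_sum x PP + 1 / (real p - 1) * smooth_sum (x div p) PP"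
proof (induction x rule: less_induct)
  case (less x)
  have p1: "p > 1" using p prime_gt_1_nat by blast
  show ?case
  proof (cases "x = 0")
    case True thus ?thesis by (simp add: smooth_sum_def)
  next
    case False
    have "smooth_sum (x div p) (insert p PP)
        \<le> smooth_sum (x div p) PP + 1 / (real p - 1) * smooth_sum (x div p div p) PP"
      using False p1 by (intro less) auto
    also have "\<dots> \<le> smooth_sum (x div p) PP + 1 / (real p - 1) * smooth_sum (x div p) PP"
      using p1 by (intro add_left_mono mult_left_mono smooth_sum_mono) (auto simp: div_le_dividend)
    also have "\<dots> = (real p / (real p - 1)) * smooth_sum (x div p) PP"
      using p1 by (simp add: field_simps)
    finally have "smooth_sum (x div p) (insert p PP) / real p \<le> 1 / (real p - 1) * smooth_sum (x div p) PP"
      using p1 by (simp add: field_simps)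
    thus ?thesis using smooth_sum_insert[OF p, of x] by simp
  qed
qed

lemma smooth_sum_le_sqfree_sum:
  assumes "finite PP" "\<And>p. p \<in> PP \<Longrightarrow> prime p"
  shows "smooth_sum x PP \<le> sqfree_sum (\<lambda>p. 1 / (real p - 1)) x PP"
  using assms
proof (induction PP arbitrary: x rule: finite_induct)
  case empty
  have "{n. n \<in> {1..x} \<and> prime_factors n \<subseteq> {}} = (if x \<ge> 1 then {1} else {})"
    by (auto simp: prime_factorization_empty_iff)
  thus ?case by (simp add: smooth_sum_def sqfree_sum_empty)
next
  case (insert p PP)
  have p: "prime p" using insert.prems by simp
  have "smooth_sum x (insert p PP) \<le> smooth_sum x PP + 1 / (real p - 1) * smooth_sum (x div p) PP"
    using insert p by (intro smooth_sum_insert_le) auto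
  also have "\<dots> \<le> sqfree_sum (\<lambda>p. 1 / (real p - 1)) x PP
      + 1 / (real p - 1) * sqfree_sum (\<lambda>p. 1 / (real p - 1)) (x div p) PP"
    using insert prime_gt_1_nat[OF p] by (intro add_mono mult_left_mono insert.IH) auto
  also have "\<dots> = sqfree_sum (\<lambda>p. 1 / (real p - 1)) x (insert p PP)"
    using insert p by (simp add: sqfree_sum_insert prime_gt_0_nat)
  finally show ?case .
qed

text \<open>All \<open>n\<close> up to \<open>x\<close> have their prime factors below
  \<open>x\<close>, so the harmonic sum is a smooth sum. Grouping the \<open>n\<close> by their
  squarefree kernel gives the weights \<open>1 / (p - 1)\<close>.\<close>

lemma ln_le_sqfree_sum:
  assumes x: "x \<ge> 1"
  shows "ln (real x) \<le> sqfree_sum (\<lambda>p. 1 / (real p - 1)) x (primes_upto x)"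
proof -
  have "ln (real x) \<le> ln (real x + 1)" using x by simp
  also have "\<dots> \<le> harm x" by (rule ln_le_harm)
  also have "harm x = smooth_sum x (primes_upto x)"
    unfolding harm_def smooth_sum_def
    by (intro sum.cong) (auto simp: primes_upto_def in_prime_factors_iff divide_inverse
          dest!: dvd_imp_le)
  also have "\<dots> \<le> sqfree_sum (\<lambda>p. 1 / (real p - 1)) x (primes_upto x)"
    by (intro smooth_sum_le_sqfree_sum) (auto simp: primes_upto_def)
  finally show ?thesis .
qed

text \<open>The second moment is applied at level \<open>x ^ k\<close>. There the main term
  dominates the \<open>k\<close>-th power of the one-dimensional sum up to \<open>x\<close>, which
  is at least \<open>ln x\<close> up to the factor for \<open>D\<close>; so no asymptotic evaluation
  of a \<open>k\<close>-dimensional sum occurs. \<open>D\<close> collects the primes below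
  \<open>2 * k\<close> and those where fewer than \<open>k\<close> classes are removed.\<close>

lemma sieve_bound:
  fixes \<Omega> :: "nat \<Rightarrow> nat set" and x N k :: nat and M D :: "nat set"
  assumes x: "x \<ge> 2" and k: "k \<ge> 1"
    and D: "finite D" "\<And>p. p \<in> D \<Longrightarrow> prime p" "\<And>p. prime p \<Longrightarrow> p < 2 * k \<Longrightarrow> p \<in> D"
    and om: "\<And>p. p \<in> primes_upto x - D \<Longrightarrow> \<Omega> p \<subseteq> {..<p} \<and> card (\<Omega> p) = k"
    and M: "M \<subseteq> {..<N}" "\<And>m p. m \<in> M \<Longrightarrow> p \<in> primes_upto x - D \<Longrightarrow> m mod p \<notin> \<Omega> p"
  shows "real (card M) \<le> real N * ((\<Prod>p\<in>D. real p / (real p - 1)) / ln (real x)) ^ k + real x ^ (6 * k)"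
proof -
  define PP where "PP = primes_upto x - D"
  define L where "L = sqfree_sum (\<lambda>p. real k / (real p - real k)) (x ^ k) PP"
  define V where "V = (\<Prod>p\<in>D. real p / (real p - 1))"
  have fin: "finite PP" by (simp add: PP_def primes_upto_def)
  have pr: "prime p" if "p \<in> PP" for p using that by (simp add: PP_def primes_upto_def)
  have pk: "2 * k \<le> p" if "p \<in> PP" for p
    using that D(3)[of p] pr[of p] by (force simp: PP_def)
  have lnx: "ln (real x) > 0" using x by simp
  have g: "1 / (real p - 1) \<ge> 0" "p > 0" "1 + 1 / (real p - 1) = real p / (real p - 1)" if "prime p" for p
    using prime_gt_1_nat[OF that] by (auto simp: field_simps)
  have "real p / (real p - 1) > 0" if "p \<in> D" for p
    using prime_gt_1_nat[OF D(2)[OF that]] by simp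
  hence V0: "V > 0" unfolding V_def by (intro prod_pos)
  have "ln (real x) \<le> sqfree_sum (\<lambda>p. 1 / (real p - 1)) x (primes_upto x)"
    using x by (intro ln_le_sqfree_sum) auto
  also have "\<dots> \<le> sqfree_sum (\<lambda>p. 1 / (real p - 1)) x (D \<union> PP)"
    unfolding sqfree_sum_def
  proof (rule sum_mono2)
    fix S assume "S \<in> {S. S \<subseteq> D \<union> PP \<and> \<Prod>S \<le> x} - {S. S \<subseteq> primes_upto x \<and> \<Prod>S \<le> x}"
    thus "0 \<le> (\<Prod>p\<in>S. 1 / (real p - 1))"
      using g(1) D(2) pr by (intro prod_nonneg) blast
  qed (use fin D(1) in \<open>auto simp: PP_def\<close>)
  also have "\<dots> \<le> (\<Prod>p\<in>D. 1 + 1 / (real p - 1)) * sqfree_sum (\<lambda>p. 1 / (real p - 1)) x PP"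
    using D fin pr g by (intro sqfree_sum_union_le) auto
  also have "(\<Prod>p\<in>D. 1 + 1 / (real p - 1)) = V"
    unfolding V_def using g(3) D(2) by (intro prod.cong) auto
  finally have "ln (real x) / V \<le> sqfree_sum (\<lambda>p. 1 / (real p - 1)) x PP"
    using V0 by (simp add: field_simps)
  hence "(ln (real x) / V) ^ k \<le> sqfree_sum (\<lambda>p. 1 / (real p - 1)) x PP ^ k"
    using lnx V0 by (intro power_mono) auto
  also have "\<dots> \<le> sqfree_sum (\<lambda>p. (1 + 1 / (real p - 1)) ^ k - 1) (x ^ k) PP"
    using fin pr g by (intro sqfree_sum_power) auto
  also have "\<dots> \<le> L"
    unfolding L_def
  proof (rule sqfree_sum_mono[OF fin])
    fix p assume p: "p \<in> PP"
    note gp = g[OF pr[OF p]]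
    show "0 \<le> (1 + 1 / (real p - 1)) ^ k - 1" using gp(1) by simp
    have p2: "real p \<ge> 2 * real k" "real k \<ge> 1" using pk[OF p] k by linarith+
    \<comment> \<open>Bernoulli's inequality turns the local factor
      \<open>(1 + 1 / (p - 1)) ^ k\<close> of the power into the local factor
      \<open>1 + k / (p - k)\<close> of the sieve weight.\<close>
    have "1 - real k / real p \<le> (1 - 1 / real p) ^ k"
      using Bernoulli_inequality[of "- (1 / real p)" k] p2 by simp
    moreover have "1 - real k / real p > 0" using p2 by simp
    ultimately have "1 / (1 - 1 / real p) ^ k \<le> 1 / (1 - real k / real p)"
      by (intro divide_left_mono) auto
    moreover have "1 / (1 - 1 / real p) ^ k = (1 + 1 / (real p - 1)) ^ k"
    proof -
      have "1 / (1 - 1 / real p) = 1 + 1 / (real p - 1)" using p2 by (simp add: field_simps)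
      thus ?thesis by (metis power_one_over)
    qed
    moreover have "1 / (1 - real k / real p) = 1 + real k / (real p - real k)"
      using p2 by (simp add: field_simps)
    ultimately show "(1 + 1 / (real p - 1)) ^ k - 1 \<le> real k / (real p - real k)" by simp
  qed simp
  finally have L: "(ln (real x) / V) ^ k \<le> L" .
  have "0 < (ln (real x) / V) ^ k" using lnx V0 by simp
  hence L0: "L > 0" using L by linarith
  \<comment> \<open>The empty set contributes 1. Hence dividing the error by the square of
    \<open>L\<close> does not enlarge it.\<close>
  have L1: "L \<ge> 1"
  proof -
    have "(\<Sum>S\<in>{{} :: nat set}. \<Prod>p\<in>S. real k / (real p - real k)) \<le> L"
      unfolding L_def sqfree_sum_def
    proof (rule sum_mono2)
      fix S assume S: "S \<in> {S. S \<subseteq> PP \<and> \<Prod>S \<le> x ^ k} - {{}}"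
      have "0 \<le> real k / (real p - real k)" if "p \<in> S" for p
        using S that pk[of p] by auto
      thus "0 \<le> (\<Prod>p\<in>S. real k / (real p - real k))" by (intro prod_nonneg)
    qed (use fin x in auto)
    thus ?thesis by simp
  qed
  have "real (card M) * L\<^sup>2 \<le> real N * L + real (x ^ k) ^ 6"
    unfolding L_def sqfree_sum_def
    by (rule sieve_second_moment[where \<Omega> = \<Omega>]) (use fin pr k pk om M in \<open>auto simp: PP_def\<close>)
  hence "real (card M) \<le> real N / L + real x ^ (6 * k) / L\<^sup>2"
    using L0 by (simp add: field_simps power2_eq_square power_mult[symmetric] mult.commute)
  also have "real x ^ (6 * k) / L\<^sup>2 \<le> real x ^ (6 * k) / 1"
    using L1 by (intro divide_left_mono) auto
  also have "real N / L \<le> real N / (ln (real x) / V) ^ k"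
    using L L0 \<open>0 < (ln (real x) / V) ^ k\<close> by (intro divide_left_mono) auto
  also have "real N / (ln (real x) / V) ^ k = real N * (V / ln (real x)) ^ k"
    by (simp add: power_divide)
  finally show ?thesis by (simp add: V_def)
qed

section \<open>Primes in short progressions and Chebyshev bounds\<close>

text \<open>The primes in the class are values \<open>q * m + r\<close>, and every prime
  \<open>p\<close> other than \<open>q\<close> forbids one residue of \<open>m\<close>: a sieve of
  dimension one. Primes up to \<open>x\<close> would be struck out by themselves and are added as
  the term \<open>x\<close>.\<close>

lemma card_primes_residue_class:
  fixes n x q r :: nat
  assumes q: "prime q" and x: "x \<ge> 2"
  shows "real (card {p \<in> primes_upto n. p mod q = r})
    \<le> (real n / real q + 1) * (4 / ln (real x)) + real x + real x ^ 6"
proof -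
  define N where "N = n div q + 1"
  define M where "M = {m. m < N \<and> prime (q * m + r) \<and> q * m + r > x}"
  \<comment> \<open>The prime 2 is below \<open>2 * k\<close> for \<open>k = 1\<close>, and
    \<open>q\<close> has no inverse modulo itself. The two local factors are at most 2 each, whence
    the constant 4.\<close>
  define D where "D = {2, q}"
  define \<Omega> where "\<Omega> = (\<lambda>p. {m. m < p \<and> p dvd q * m + r})"
  have q1: "q > 1" using q prime_gt_1_nat by blast
  have fM: "finite M" by (simp add: M_def)
  have om: "\<Omega> p \<subseteq> {..<p} \<and> card (\<Omega> p) = 1" if p: "p \<in> primes_upto x - D" for p
  proof -
    have pp: "prime p" "p \<noteq> q" using p by (auto simp: primes_upto_def D_def)
    hence cop: "coprime q p" using q primes_coprime by blast
    have p0: "p > 0" using pp prime_gt_0_nat by blast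
    obtain y where y: "[q * y = 1] (mod p)" using cong_solve_coprime_nat[OF cop] by auto
    define m0 where "m0 = (y * ((p - 1) * r)) mod p"
    have "[q * m0 = q * (y * ((p - 1) * r))] (mod p)"
      unfolding m0_def by (intro cong_mult) (auto simp: cong_def)
    also have "q * (y * ((p - 1) * r)) = (q * y) * ((p - 1) * r)" by simp
    also have "[(q * y) * ((p - 1) * r) = 1 * ((p - 1) * r)] (mod p)"
      using y by (intro cong_mult) auto
    finally have "[q * m0 + r = (p - 1) * r + r] (mod p)" by (intro cong_add) auto
    also have "(p - 1) * r + r = p * r" using p0 by (cases p) auto
    finally have m0: "p dvd q * m0 + r" by (simp add: cong_dvd_iff)
    have "\<Omega> p = {m0}"
    proof
      show "{m0} \<subseteq> \<Omega> p" using m0 p0 by (auto simp: \<Omega>_def m0_def)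
      show "\<Omega> p \<subseteq> {m0}"
      proof
        fix m assume m: "m \<in> \<Omega> p"
        have "[q * m + r = q * m0 + r] (mod p)"
          using m m0 by (auto simp: \<Omega>_def cong_def)
        hence "[q * m = q * m0] (mod p)" by (simp add: cong_add_rcancel_nat)
        hence "[m = m0] (mod p)" using cop by (simp add: cong_mult_lcancel_nat)
        thus "m \<in> {m0}" using m p0 by (auto simp: \<Omega>_def m0_def cong_def)
      qed
    qed
    thus ?thesis using p0 by (auto simp: \<Omega>_def)
  qed
  have "real (card M) \<le> real N * ((\<Prod>p\<in>D. real p / (real p - 1)) / ln (real x)) ^ 1 + real x ^ (6 * 1)"
  proof (rule sieve_bound[where \<Omega> = \<Omega>])
    show "p \<in> D" if "prime p" "p < 2 * 1" for p :: nat using that prime_ge_2_nat[of p] by auto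
    show "m mod p \<notin> \<Omega> p" if m: "m \<in> M" and p: "p \<in> primes_upto x - D" for m p
    proof
      assume "m mod p \<in> \<Omega> p"
      hence "p dvd q * (m mod p) + r" by (simp add: \<Omega>_def)
      moreover have "[q * (m mod p) + r = q * m + r] (mod p)"
        by (intro cong_add cong_mult) (auto simp: cong_def)
      ultimately have "p dvd q * m + r" using cong_dvd_iff by blast
      moreover have "prime (q * m + r)" "q * m + r > x" using m by (auto simp: M_def)
      ultimately have "p = 1 \<or> p = q * m + r" by (simp add: prime_nat_iff)
      thus False using p \<open>q * m + r > x\<close> by (auto simp: primes_upto_def)
    qed
  qed (use x q om in \<open>auto simp: D_def M_def\<close>)
  also have "(\<Prod>p\<in>D. real p / (real p - 1)) \<le> 4"
  proof (cases "q = 2")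
    case False
    hence "real q / (real q - 1) \<le> 2" using q1 by (simp add: field_simps)
    thus ?thesis using False by (simp add: D_def)
  qed (simp add: D_def)
  finally have cM: "real (card M) \<le> real N * (4 / ln (real x)) + real x ^ 6"
    using x by (simp add: divide_right_mono mult_left_mono)
  have sub: "{p \<in> primes_upto n. p mod q = r} \<subseteq> {1..x} \<union> (\<lambda>m. q * m + r) ` M"
  proof
    fix p assume p: "p \<in> {p \<in> primes_upto n. p mod q = r}"
    hence pp: "prime p" "p \<le> n" "p mod q = r" by (auto simp: primes_upto_def)
    have eq: "p = q * (p div q) + r" using pp by (metis mult_div_mod_eq)
    have "p div q < N" using pp by (simp add: N_def div_le_mono less_Suc_eq_le)
    hence "p div q \<in> M" if "p > x" using pp eq that by (simp add: M_def)
    thus "p \<in> {1..x} \<union> (\<lambda>m. q * m + r) ` M"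
      using eq pp(1) prime_gt_0_nat[OF pp(1)] by (cases "p > x") (auto simp: Suc_le_eq)
  qed
  have "card {p \<in> primes_upto n. p mod q = r} \<le> card ({1..x} \<union> (\<lambda>m. q * m + r) ` M)"
    using sub fM by (intro card_mono) auto
  also have "\<dots> \<le> card {1..x} + card ((\<lambda>m. q * m + r) ` M)" by (rule card_Un_le)
  also have "\<dots> \<le> x + card M" using card_image_le[OF fM] by simp
  finally have "real (card {p \<in> primes_upto n. p mod q = r}) \<le> real x + real (card M)"
    by (simp flip: of_nat_add)
  also have "\<dots> \<le> real x + (real N * (4 / ln (real x)) + real x ^ 6)" using cM by simp
  also have "real N * (4 / ln (real x)) \<le> (real n / real q + 1) * (4 / ln (real x))"
  proof (rule mult_right_mono)
    have "real (n div q) * real q \<le> real n"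
      by (metis of_nat_le_iff of_nat_mult times_div_less_eq_dividend mult.commute)
    thus "real N \<le> real n / real q + 1" using q1 by (simp add: N_def field_simps)
  qed (use x in auto)
  finally show ?thesis by simp
qed

text \<open>For \<open>q\<close> up to \<open>(ln n)\<^sup>2\<close> the sieve error, of order
  \<open>sqrt n\<close>, stays below \<open>n / (q * ln n)\<close>. This range is enough for the
  moment: a tuple has too few collision primes beyond it to matter.\<close>

lemma brun_titchmarsh_small_modulus:
  "\<exists>n0. \<forall>n\<ge>n0. \<forall>q r. prime q \<longrightarrow> real q \<le> (ln (real n))\<^sup>2 \<longrightarrow>
     real (card {p \<in> primes_upto n. p mod q = r}) \<le> 200 * real n / (real q * ln (real n))"
proof -
  have ev1: "eventually (\<lambda>n::nat. real n powr (1/12) \<ge> 3) sequentially" by real_asymp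
  have ev2: "eventually (\<lambda>n::nat. real n powr (1/12) - 1 \<ge> real n powr (1/24)) sequentially" by real_asymp
  have ev3: "eventually (\<lambda>n::nat. 2 * real n powr (1/2) \<le> real n / (ln (real n)) ^ 3) sequentially" by real_asymp
  have ev4: "eventually (\<lambda>n::nat. (ln (real n))\<^sup>2 \<le> real n) sequentially" by real_asymp
  have ev5: "eventually (\<lambda>n::nat. n \<ge> 3) sequentially" by (rule eventually_ge_at_top)
  have "eventually (\<lambda>n::nat. \<forall>q r. prime q \<longrightarrow> real q \<le> (ln (real n))\<^sup>2 \<longrightarrow>
     real (card {p \<in> primes_upto n. p mod q = r}) \<le> 200 * real n / (real q * ln (real n))) sequentially"
    using ev1 ev2 ev3 ev4 ev5
  proof eventually_elim
    case (elim n)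
    show ?case
    proof (intro allI impI)
      fix q r :: nat assume q: "prime q" and qn: "real q \<le> (ln (real n))\<^sup>2"
      \<comment> \<open>The exponent 1/12 keeps \<open>x ^ 6\<close> below \<open>sqrt n\<close>.
        Rounding down is paid for by using only \<open>x \<ge> n powr (1/24)\<close>, so
        \<open>4 / ln x\<close> becomes \<open>96 / ln n\<close>; the term \<open>+ 1\<close> in the
        number of values doubles this to 192.\<close>
      define x where "x = nat \<lfloor>real n powr (1/12)\<rfloor>"
      have n: "real n \<ge> 3" using elim(5) by simp
      have x3: "x \<ge> 2" unfolding x_def using elim(1) by linarith
      have xu: "real x \<le> real n powr (1/12)" unfolding x_def using n by (simp add: of_nat_floor)
      have xl: "real x \<ge> real n powr (1/24)" unfolding x_def using elim(2) by linarith
      have q0: "real q > 0" using q prime_gt_0_nat by simp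
      have l0: "ln (real n) > 0" using n by simp
      have "ln (real n) / 24 = ln (real n powr (1/24))" using n by (simp add: ln_powr)
      also have "\<dots> \<le> ln (real x)" using xl n by (intro ln_mono) auto
      finally have lx: "ln (real x) \<ge> ln (real n) / 24" .
      have x6: "real x ^ 6 \<le> real n powr (1/2)"
      proof -
        have "real x ^ 6 \<le> (real n powr (1/12)) ^ 6" using xu by (intro power_mono) auto
        also have "\<dots> = real n powr (1/2)" using n by (simp add: powr_power)
        finally show ?thesis .
      qed
      have x1: "real x \<le> real x ^ 6" using x3 by (simp add: self_le_power)
      have t1: "4 / ln (real x) \<le> 96 / ln (real n)"
        using lx l0 by (simp add: field_simps)
      have qn1: "1 \<le> real n / real q" using qn elim(4) q0 by (simp add: field_simps)
      have "real (card {p \<in> primes_upto n. p mod q = r})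
          \<le> (real n / real q + 1) * (4 / ln (real x)) + real x + real x ^ 6"
        by (rule card_primes_residue_class[OF q x3])
      also have "\<dots> \<le> (2 * (real n / real q)) * (96 / ln (real n)) + 2 * real n powr (1/2)"
      proof -
        have "(real n / real q + 1) * (4 / ln (real x)) \<le> (2 * (real n / real q)) * (96 / ln (real n))"
          using qn1 t1 x3 by (intro mult_mono) auto
        thus ?thesis using x6 x1 by linarith
      qed
      also have "2 * real n powr (1/2) \<le> real n / (ln (real n)) ^ 3" by (rule elim(3))
      also have "\<dots> \<le> real n / (real q * ln (real n))"
      proof (rule divide_left_mono)
        have "real q * ln (real n) \<le> (ln (real n))\<^sup>2 * ln (real n)"
          using qn l0 by (intro mult_right_mono) auto
        thus "real q * ln (real n) \<le> ln (real n) ^ 3" by (simp add: power_numeral_reduce)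
      qed (use q0 l0 in auto)
      also have "(2 * (real n / real q)) * (96 / ln (real n)) = 192 * (real n / (real q * ln (real n)))"
        by simp
      finally have "real (card {p \<in> primes_upto n. p mod q = r}) \<le> 193 * (real n / (real q * ln (real n)))"
        by simp
      also have "\<dots> \<le> 200 * (real n / (real q * ln (real n)))"
        using q0 l0 by (intro mult_right_mono) auto
      finally show "real (card {p \<in> primes_upto n. p mod q = r}) \<le> 200 * real n / (real q * ln (real n))"
        by simp
    qed
  qed
  thus ?thesis by (simp add: eventually_sequentially)
qed

lemma chebyshev_upper:
  "\<exists>C>0. \<forall>n\<ge>2. real (card (primes_upto n)) \<le> C * real n / ln (real n)"
proof -
  obtain n0 where n0: "\<And>n q r. n \<ge> n0 \<Longrightarrow> prime q \<Longrightarrow> real q \<le> (ln (real n))\<^sup>2 \<Longrightarrow>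
     real (card {p \<in> primes_upto n. p mod q = r}) \<le> 200 * real n / (real q * ln (real n))"
    using brun_titchmarsh_small_modulus by blast
  have "eventually (\<lambda>n::nat. 2 \<le> (ln (real n))\<^sup>2 \<and> 1 \<le> real n / ln (real n) \<and> n \<ge> n0) sequentially"
    by (intro eventually_conj eventually_ge_at_top) real_asymp+
  then obtain n1 where n1: "\<And>n. n \<ge> n1 \<Longrightarrow> 2 \<le> (ln (real n))\<^sup>2 \<and> 1 \<le> real n / ln (real n) \<and> n \<ge> n0"
    by (auto simp: eventually_sequentially)
  \<comment> \<open>The summand 201 serves large \<open>n\<close>; the logarithm covers the finitely
    many \<open>n < n1\<close> through the trivial bound by \<open>n\<close>.\<close>
  define C where "C = 201 + ln (real (n1 + 2))"
  have C0: "C > 201" by (simp add: C_def)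
  have "real (card (primes_upto n)) \<le> C * real n / ln (real n)" if n: "n \<ge> 2" for n
  proof (cases "n \<ge> n1")
    case True
    have l: "ln (real n) > 0" using n by simp
    have sub: "primes_upto n \<subseteq> insert 2 {p \<in> primes_upto n. p mod 2 = 1}"
      by (auto simp: primes_upto_def prime_odd_nat)
         (metis (full_types) even_iff_mod_2_eq_zero not_mod_2_eq_1_eq_0 prime_nat_iff
           primes_dvd_imp_eq two_is_prime_nat dvd_refl One_nat_def)
    have "card (primes_upto n) \<le> card (insert 2 {p \<in> primes_upto n. p mod 2 = 1})"
      using sub by (intro card_mono) (auto simp: primes_upto_def)
    also have "\<dots> \<le> 1 + card {p \<in> primes_upto n. p mod 2 = 1}"
      by (simp add: card_insert_le_m1 card_insert_if primes_upto_def)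
    finally have "real (card (primes_upto n)) \<le> 1 + real (card {p \<in> primes_upto n. p mod 2 = 1})"
      by (simp flip: of_nat_Suc)
    also have "real (card {p \<in> primes_upto n. p mod 2 = 1}) \<le> 200 * real n / (real 2 * ln (real n))"
      using n1[OF True] by (intro n0) auto
    also have "\<dots> \<le> 200 * (real n / ln (real n))" using l by (simp add: field_simps)
    also have "1 \<le> real n / ln (real n)" using n1[OF True] by simp
    finally have "real (card (primes_upto n)) \<le> 201 * (real n / ln (real n))" by simp
    also have "\<dots> \<le> C * (real n / ln (real n))" using C0 l by (intro mult_right_mono) auto
    finally show ?thesis by simp
  next
    case False
    have l: "ln (real n) > 0" using n by simp
    have "card (primes_upto n) \<le> card {1..n}"
      by (intro card_mono) (auto simp: primes_upto_def Suc_le_eq prime_gt_0_nat)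
    hence "real (card (primes_upto n)) \<le> real n" by simp
    also have "ln (real n) \<le> C" using False n by (auto simp: C_def intro: order_trans[of _ "ln (real (n1+2))"])
    hence "real n \<le> C * real n / ln (real n)" using l by (simp add: pos_le_divide_eq mult.commute[of C] mult_left_mono)
    finally show ?thesis .
  qed
  thus ?thesis using C0 by (intro exI[of _ C]) auto
qed

section \<open>Sums and products over primes by dyadic blocks\<close>

lemma finite_primes_upto [simp]: "finite (primes_upto n)"
  by (simp add: primes_upto_def)

lemma finite_primes_between [simp]: "finite {p::nat. prime p \<and> a < p \<and> p \<le> b}"
  by (rule finite_subset[of _ "{..b}"]) auto

lemma primes_between_split:
  "a \<le> b \<Longrightarrow> b \<le> c \<Longrightarrow> {p::nat. prime p \<and> a < p \<and> p \<le> c}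
     = {p. prime p \<and> a < p \<and> p \<le> b} \<union> {p. prime p \<and> b < p \<and> p \<le> c}"
  by auto

lemma prime_ratio_bounds:
  assumes "prime p"
  shows "1 \<le> real p / (real p - 1)" "real p / (real p - 1) \<le> exp (2 / real p)"
proof -
  have p: "real p \<ge> 2" using prime_ge_2_nat[OF assms] by simp
  show "1 \<le> real p / (real p - 1)" using p by simp
  have "real p / (real p - 1) = 1 + 1 / (real p - 1)" using p by (simp add: field_simps)
  also have "\<dots> \<le> 1 + 2 / real p" using p by (simp add: field_simps)
  also have "\<dots> \<le> exp (2 / real p)" by (rule exp_ge_add_one_self)
  finally show "real p / (real p - 1) \<le> exp (2 / real p)" .
qed

lemma sum_prime_dyadic_le:
  fixes f :: "nat \<Rightarrow> real"
  assumes C: "\<And>n. n \<ge> 2 \<Longrightarrow> real (card (primes_upto n)) \<le> C * real n / ln (real n)"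
    and c: "\<And>p. p > 2 ^ j \<Longrightarrow> f p \<le> c" and c0: "c \<ge> 0"
  shows "(\<Sum>p | prime p \<and> 2 ^ j < p \<and> p \<le> 2 ^ Suc j. f p) \<le> 2 * C / ln 2 * 2 ^ j / real (Suc j) * c"
proof -
  let ?A = "{p::nat. prime p \<and> 2 ^ j < p \<and> p \<le> 2 ^ Suc j}"
  have "(\<Sum>p\<in>?A. f p) \<le> (\<Sum>p\<in>?A. c)" by (intro sum_mono c) auto
  also have "\<dots> = real (card ?A) * c" by simp
  also have "real (card ?A) \<le> real (card (primes_upto (2 ^ Suc j)))"
    by (intro of_nat_mono card_mono) (auto simp: primes_upto_def)
  also have "\<dots> \<le> C * real (2 ^ Suc j) / ln (real (2 ^ Suc j))"
    by (intro C) simp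
  also have "\<dots> = 2 * C / ln 2 * 2 ^ j / real (Suc j)"
    by (simp add: ln_mult ln_realpow field_simps)
  finally show ?thesis using c0 by (simp add: mult_right_mono)
qed

text \<open>An upper bound of Mertens type. The primes between \<open>2 ^ J\<close> and
  \<open>2 ^ Suc J\<close> contribute a factor of at most \<open>exp (c / Suc J)\<close>, and these
  exponents add up to a harmonic number. The result is a power of \<open>J\<close>, hence a power of
  \<open>k\<close> once \<open>J\<close> is a multiple of \<open>k ^ 3\<close>.\<close>

lemma prod_primes_upto_le:
  "\<exists>B>0. \<forall>J\<ge>1. (\<Prod>p\<in>primes_upto (2 ^ J). real p / (real p - 1)) \<le> exp (B * (1 + ln (real J)))"
proof -
  obtain C where C: "C > 0" "\<And>n. n \<ge> 2 \<Longrightarrow> real (card (primes_upto n)) \<le> C * real n / ln (real n)"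
    using chebyshev_upper by blast
  define c where "c = 4 * C / ln 2"
  have c0: "c > 0" using C by (simp add: c_def)
  define V where "V = (\<lambda>n. \<Prod>p\<in>primes_upto n. real p / (real p - 1))"
  have fac: "0 < real p / (real p - 1)" "real p / (real p - 1) \<le> exp (2 / real p)" if "prime p" for p
    using prime_ratio_bounds[OF that] by linarith+
  have V: "V (2 ^ J) \<le> exp (c * harm J)" for J
  proof (induction J)
    case 0
    have "primes_upto (2 ^ 0) = {}" by (auto simp: primes_upto_def dest: prime_gt_1_nat)
    thus ?case by (simp add: V_def harm_def)
  next
    case (Suc J)
    let ?A = "{p::nat. prime p \<and> 2 ^ J < p \<and> p \<le> 2 ^ Suc J}"
    have finA: "finite ?A" by (rule finite_primes_between)
    have "(2::nat) ^ J \<le> 2 ^ Suc J" by simp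
    hence "primes_upto (2 ^ Suc J) = primes_upto (2 ^ J) \<union> ?A"
      unfolding primes_upto_def by fastforce
    moreover have "primes_upto (2 ^ J) \<inter> ?A = {}" by (auto simp: primes_upto_def)
    ultimately have "V (2 ^ Suc J) = V (2 ^ J) * (\<Prod>p\<in>?A. real p / (real p - 1))"
      unfolding V_def using finA by (simp add: prod.union_disjoint)
    also have "\<dots> \<le> exp (c * harm J) * exp (\<Sum>p\<in>?A. 2 / real p)"
    proof (rule mult_mono)
      have "(\<Prod>p\<in>?A. real p / (real p - 1)) \<le> (\<Prod>p\<in>?A. exp (2 / real p))"
        using fac by (intro prod_mono) (auto intro: less_imp_le)
      also have "\<dots> = exp (\<Sum>p\<in>?A. 2 / real p)" using finA by (simp add: exp_sum)
      finally show "(\<Prod>p\<in>?A. real p / (real p - 1)) \<le> exp (\<Sum>p\<in>?A. 2 / real p)" .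
      show "0 \<le> (\<Prod>p\<in>?A. real p / (real p - 1))" using fac by (intro prod_nonneg) (auto intro: less_imp_le)
    qed (use Suc in auto)
    also have "(\<Sum>p\<in>?A. 2 / real p) \<le> 2 * C / ln 2 * 2 ^ J / real (Suc J) * (2 / 2 ^ J)"
    proof (rule sum_prime_dyadic_le[OF C(2)])
      fix p :: nat assume "p > 2 ^ J"
      hence "real p \<ge> 2 ^ J" by (metis less_imp_le of_nat_le_iff of_nat_numeral of_nat_power)
      thus "2 / real p \<le> 2 / 2 ^ J"
        using \<open>p > 2 ^ J\<close> by (intro divide_left_mono mult_pos_pos) auto
    qed auto
    also have "2 * C / ln 2 * 2 ^ J / real (Suc J) * (2 / 2 ^ J) = c / real (Suc J)"
      by (simp add: c_def)
    also have "exp (c * harm J) * exp (c / real (Suc J)) = exp (c * harm (Suc J))"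
      by (simp add: harm_Suc field_simps flip: exp_add)
    finally show ?case by simp
  qed
  have harm: "harm J \<le> 1 + ln (real J)" if "J \<ge> 1" for J
    using that
  proof (induction J rule: dec_induct)
    case base thus ?case by (simp add: harm_def)
  next
    case (step J)
    have J: "real J > 0" using step by simp
    have "ln (real J / real (Suc J)) \<le> real J / real (Suc J) - 1"
      using J by (intro ln_le_minus_one) auto
    hence "1 / real (Suc J) \<le> ln (real (Suc J)) - ln (real J)"
      using J by (simp add: ln_div field_simps)
    thus ?case using step by (simp add: harm_Suc divide_inverse)
  qed
  have "V (2 ^ J) \<le> exp (c * (1 + ln (real J)))" if "J \<ge> 1" for J
  proof -
    have "c * harm J \<le> c * (1 + ln (real J))" using harm[OF that] c0 by (intro mult_left_mono) auto
    thus ?thesis using V[of J] by (meson exp_le_cancel_iff order_trans)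
  qed
  thus ?thesis using c0 unfolding V_def by blast
qed

text \<open>The additional \<open>ln p\<close> makes the block above \<open>2 ^ j\<close> contribute
  a multiple of \<open>1 / (j * (j + 1))\<close>. These telescope from \<open>1 / J\<close>, and the
  bound does not depend on \<open>z\<close>.\<close>

lemma sum_prime_tail_le:
  "\<exists>B>0. \<forall>J\<ge>1. \<forall>z::nat. (\<Sum>p | prime p \<and> 2 ^ J < p \<and> p \<le> z. 1 / (real p * ln (real p))) \<le> B / real J"
proof -
  obtain C where C: "C > 0" "\<And>n. n \<ge> 2 \<Longrightarrow> real (card (primes_upto n)) \<le> C * real n / ln (real n)"
    using chebyshev_upper by blast
  define c where "c = 2 * C / (ln 2)\<^sup>2"
  have c0: "c > 0" using C by (simp add: c_def)
  define f where "f = (\<lambda>p::nat. 1 / (real p * ln (real p)))"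
  have f0: "f p \<ge> 0" if "prime p" for p using prime_gt_1_nat[OF that] by (simp add: f_def)
  have main: "(\<Sum>p | prime p \<and> 2 ^ J < p \<and> p \<le> 2 ^ (J + K). f p) \<le> c * (1 / real J - 1 / real (J + K))"
    if J: "J \<ge> 1" for J K
  proof (induction K)
    case 0
    have "{p::nat. prime p \<and> 2 ^ J < p \<and> p \<le> 2 ^ (J + 0)} = {}" by auto
    thus ?case by (simp only: sum.empty) simp
  next
    case (Suc K)
    define j where "j = J + K"
    have j1: "j \<ge> 1" using J by (simp add: j_def)
    let ?A = "{p::nat. prime p \<and> 2 ^ J < p \<and> p \<le> 2 ^ j}"
    let ?B = "{p::nat. prime p \<and> 2 ^ j < p \<and> p \<le> 2 ^ Suc j}"
    have fin: "finite ?A" "finite ?B" by (rule finite_primes_between)+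
    have "(2::nat) ^ J \<le> 2 ^ j" "(2::nat) ^ j \<le> 2 ^ Suc j" by (auto simp: j_def)
    hence "{p::nat. prime p \<and> 2 ^ J < p \<and> p \<le> 2 ^ (J + Suc K)} = ?A \<union> ?B"
      using primes_between_split[of "2 ^ J" "2 ^ j" "2 ^ Suc j"] by (simp add: j_def)
    hence "(\<Sum>p | prime p \<and> 2 ^ J < p \<and> p \<le> 2 ^ (J + Suc K). f p) = sum f ?A + sum f ?B"
      using fin by (simp add: sum.union_disjoint[symmetric] disjoint_iff)
    also have "sum f ?B \<le> 2 * C / ln 2 * 2 ^ j / real (Suc j) * (1 / (2 ^ j * (real j * ln 2)))"
    proof (rule sum_prime_dyadic_le[OF C(2)])
      fix p :: nat assume "p > 2 ^ j"
      hence p: "real p \<ge> 2 ^ j" by (metis less_imp_le of_nat_le_iff of_nat_numeral of_nat_power)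
      have p0: "(0::real) < 2 ^ j" by simp
      have "real j * ln 2 = ln (2 ^ j)" by (simp add: ln_realpow)
      also have "\<dots> \<le> ln (real p)" using p p0 by (intro ln_mono) auto
      finally have "2 ^ j * (real j * ln 2) \<le> real p * ln (real p)"
        using p j1 by (intro mult_mono) auto
      moreover have "0 < 2 ^ j * (real j * ln (2::real))" using j1 by simp
      ultimately show "f p \<le> 1 / (2 ^ j * (real j * ln 2))"
        unfolding f_def by (intro frac_le) auto
    qed (use C in auto)
    also have "\<dots> = c * (1 / real j - 1 / real (Suc j))"
      using j1 by (simp add: c_def field_simps power2_eq_square)
    also have "sum f ?A \<le> c * (1 / real J - 1 / real j)" using Suc by (simp add: j_def)
    finally show ?case by (simp add: j_def algebra_simps)
  qed
  have "(\<Sum>p | prime p \<and> 2 ^ J < p \<and> p \<le> z. f p) \<le> c / real J" if J: "J \<ge> 1" for J z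
  proof -
    have "z \<le> 2 ^ z" by (simp add: less_imp_le)
    also have "(2::nat) ^ z \<le> 2 ^ (J + z)" by simp
    finally have z: "z \<le> 2 ^ (J + z)" .
    have fin: "finite {p::nat. prime p \<and> 2 ^ J < p \<and> p \<le> 2 ^ (J + z)}" by (rule finite_primes_between)
    have "(\<Sum>p | prime p \<and> 2 ^ J < p \<and> p \<le> z. f p) \<le> (\<Sum>p | prime p \<and> 2 ^ J < p \<and> p \<le> 2 ^ (J + z). f p)"
      using z f0 by (intro sum_mono2 fin) auto
    also have "\<dots> \<le> c * (1 / real J - 1 / real (J + z))" by (rule main[OF J])
    also have "\<dots> \<le> c * (1 / real J)" using c0 by (intro mult_left_mono) auto
    finally show ?thesis by simp
  qed
  thus ?thesis using c0 unfolding f_def by blast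
qed

text \<open>Nair's observation: the entries of the Leibniz harmonic triangle are integer combinations of
  \<open>1 / 1, \<dots>, 1 / (n + 1)\<close>.\<close>

lemma choose_dvd_Lcm:
  "k \<le> n \<Longrightarrow> (n + 1) * (n choose k) dvd Lcm {1..n + 1}"
proof (induction k arbitrary: n)
  case 0
  show ?case by (auto intro!: dvd_Lcm)
next
  case (Suc k)
  then obtain m where n: "n = Suc m" and km: "k \<le> m" by (cases n) auto
  define M where "M = Lcm {1..n + 1}"
  define a b c where "a = (n + 1) * (n choose Suc k)" and "b = (n + 1) * (n choose k)"
    and "c = n * (m choose k)"
  have "Lcm {1..m + 1} dvd M" unfolding M_def using n by (intro Lcm_subset) auto
  hence cM: "c dvd M" using Suc.IH[OF km] n by (auto simp: c_def intro: dvd_trans)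
  have bM: "b dvd M" using Suc.IH[of n] Suc.prems by (simp add: b_def M_def)
  obtain s where s: "M = c * s" using cM by (elim dvdE)
  obtain t where t: "M = b * t" using bM by (elim dvdE)
  have pos: "a > 0" "b > 0" "c > 0" using n km by (auto simp: a_def b_def c_def)
  have e1: "Suc k * (n choose Suc k) = c" unfolding c_def n by (rule Suc_times_binomial)
  have e2: "(n - k) * (n choose k) = c"
    unfolding c_def n using binomial_absorb_comp[of "Suc m" k] by simp
  have e1': "real c = real (Suc k) * real (n choose Suc k)" using e1 by (metis of_nat_mult)
  have e2': "real c = (real n - real k) * real (n choose k)"
    using e2 km n by (metis Suc.prems Suc_leD of_nat_diff of_nat_mult)
  \<comment> \<open>This is the rule \<open>1 / a = 1 / c - 1 / b\<close> of the harmonic triangle.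
    Multiplied by \<open>M\<close> it shows that \<open>M / a\<close> is the integer
    \<open>s - t\<close>.\<close>
  have "real a * (real b - real c) = real b * real c"
  proof -
    have "real b - real c = (real k + 1) * real (n choose k)"
      unfolding e2' b_def by (simp add: algebra_simps)
    hence "real a * (real b - real c) = (real n + 1) * real (n choose Suc k) * ((real k + 1) * real (n choose k))"
      by (simp add: a_def algebra_simps)
    also have "\<dots> = real b * real c" unfolding e1' b_def by (simp add: algebra_simps)
    finally show ?thesis .
  qed
  hence "real a * (real b - real c) * (real s * real t) = real b * real c * (real s * real t)" by simp
  hence "real a * ((real b * real t) * real s - (real c * real s) * real t) = (real b * real t) * (real c * real s)"
    by (simp add: algebra_simps)
  hence "real a * (real M * real s - real M * real t) = real M * real M"
    using s t by (metis of_nat_mult)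
  moreover have "M \<noteq> 0" unfolding M_def by (simp add: Lcm_0_iff)
  ultimately have "real a * (real s - real t) = real M"
    by (simp add: right_diff_distrib[symmetric] mult.left_commute)
  hence "real_of_int (int a * (int s - int t)) = real_of_int (int M)" by simp
  hence "int a * (int s - int t) = int M" by (simp only: of_int_eq_iff)
  hence "int a dvd int M" by (metis dvd_triv_left)
  hence "a dvd M" by (simp only: int_dvd_int_iff)
  thus ?case unfolding a_def M_def .
qed

text \<open>Each prime enters the least common multiple with the largest power not exceeding
  \<open>N\<close>, so it contributes a factor of at most \<open>N\<close>.\<close>

lemma Lcm_upto_le:
  assumes N: "N \<ge> 1"
  shows "Lcm {1..N} \<le> N ^ card (primes_upto N)"
proof -
  define e where "e = (\<lambda>p. Max {i. p ^ i \<le> N})"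
  have fin: "finite {i. p ^ i \<le> N}" if "prime p" for p
  proof (rule finite_subset)
    show "{i. p ^ i \<le> N} \<subseteq> {..N}"
    proof
      fix i assume "i \<in> {i. p ^ i \<le> N}"
      hence "p ^ i \<le> N" by simp
      moreover have "i < 2 ^ i" by (rule less_exp)
      moreover have "(2::nat) ^ i \<le> p ^ i" using prime_ge_2_nat[OF that] by (intro power_mono) auto
      ultimately show "i \<in> {..N}" by (simp del: less_exp)
    qed
  qed simp
  have pe: "p ^ e p \<le> N" if "prime p" for p
  proof -
    have "e p \<in> {i. p ^ i \<le> N}" unfolding e_def using fin[OF that] N
      by (intro Max_in) (auto intro!: exI[of _ 0])
    thus ?thesis by simp
  qed
  have le_e: "i \<le> e p" if "prime p" "p ^ i \<le> N" for p i
    unfolding e_def using fin that by (intro Max_ge) auto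
  have "Lcm {1..N} dvd (\<Prod>p\<in>primes_upto N. p ^ e p)"
  proof (rule Lcm_least)
    fix m assume "m \<in> {1..N}"
    hence m: "m > 0" "m \<le> N" by auto
    have "m = (\<Prod>p\<in>prime_factors m. p ^ multiplicity p m)"
      using m(1) by (simp add: prime_factorization_nat)
    also have "\<dots> dvd (\<Prod>p\<in>prime_factors m. p ^ e p)"
    proof (rule prod_dvd_prod)
      fix p assume "p \<in> prime_factors m"
      hence p: "prime p" by auto
      have "p ^ multiplicity p m \<le> m" using m by (intro dvd_imp_le multiplicity_dvd) auto
      thus "p ^ multiplicity p m dvd p ^ e p" using m by (intro le_imp_power_dvd le_e p) auto
    qed
    also have "\<dots> dvd (\<Prod>p\<in>primes_upto N. p ^ e p)"
      using m by (intro prod_dvd_prod_subset) (auto simp: primes_upto_def in_prime_factors_iff dest!: dvd_imp_le)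
    finally show "m dvd (\<Prod>p\<in>primes_upto N. p ^ e p)" .
  qed
  hence "Lcm {1..N} \<le> (\<Prod>p\<in>primes_upto N. p ^ e p)"
    by (intro dvd_imp_le prod_pos) (auto simp: primes_upto_def prime_gt_0_nat)
  also have "\<dots> \<le> (\<Prod>p\<in>primes_upto N. N)" by (intro prod_mono) (auto simp: primes_upto_def pe)
  finally show ?thesis by simp
qed

text \<open>The central binomial coefficient makes the least common multiple of
  \<open>1, ..., 2 * m + 1\<close> at least \<open>4 ^ m\<close>, while it is at most
  \<open>n\<close> to the number of primes. Taking logarithms gives the bound.\<close>

lemma chebyshev_lower:
  assumes n: "n \<ge> 4"
  shows "real (card (primes_upto n)) \<ge> real n / (4 * ln (real n))"
proof -
  \<comment> \<open>The largest \<open>m\<close> with \<open>2 * m + 1 \<le> n\<close>. It satisfies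
    \<open>m \<ge> n / 4\<close> because \<open>n \<ge> 4\<close>.\<close>
  define m where "m = (n - 1) div 2"
  have m1: "m \<ge> 1" "2 * m + 1 \<le> n" "n \<le> 2 * m + 2" using n by (auto simp: m_def)
  have l0: "ln (real n) > 0" using n by simp
  have "real (4 ^ m) \<le> real ((2 * m + 1) * (2 * m choose m))"
  proof -
    have "4 ^ m / (2 * real m) \<le> real (2 * m choose m)"
      using central_binomial_lower_bound[of m] m1 by simp
    hence "4 ^ m \<le> (2 * real m) * real (2 * m choose m)" using m1 by (simp add: field_simps)
    also have "\<dots> \<le> (2 * real m + 1) * real (2 * m choose m)" by (intro mult_right_mono) auto
    finally show ?thesis by (simp add: algebra_simps)
  qed
  hence "4 ^ m \<le> (2 * m + 1) * (2 * m choose m)" by (simp only: of_nat_le_iff)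
  also have "\<dots> \<le> Lcm {1..2 * m + 1}"
    using choose_dvd_Lcm[of m "2 * m"] by (intro dvd_imp_le) (auto simp: Lcm_0_iff intro!: Nat.gr0I)
  also have "\<dots> \<le> (2 * m + 1) ^ card (primes_upto (2 * m + 1))" by (intro Lcm_upto_le) auto
  also have "\<dots> \<le> n ^ card (primes_upto (2 * m + 1))" using m1 by (intro power_mono) auto
  also have "\<dots> \<le> n ^ card (primes_upto n)"
    using m1 by (intro power_increasing card_mono) (auto simp: primes_upto_def)
  finally have "real (4 ^ m) \<le> real (n ^ card (primes_upto n))" by (simp only: of_nat_le_iff)
  hence "ln (4 ^ m) \<le> ln (real n ^ card (primes_upto n))" using n by (intro ln_mono) auto
  hence "real m * ln 4 \<le> real (card (primes_upto n)) * ln (real n)"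
    using n by (simp add: ln_realpow)
  moreover have "real m * 1 \<le> real m * ln 4"
    using exp_le ln_mono[of "exp 1" 4] by (intro mult_left_mono) auto
  moreover have "real n / 4 \<le> real m" using m1 n by simp
  ultimately have "real n / 4 \<le> real (card (primes_upto n)) * ln (real n)" by linarith
  thus ?thesis using l0 by (simp add: field_simps)
qed

section \<open>Moments of the representation function\<close>

text \<open>Jensen's inequality for weights of total mass at most 1: the missing mass is put at the
  point 0, where \<open>exp\<close> is 1. This gives the summand 1.\<close>

lemma exp_weighted_sum_le:
  fixes w x :: "'a \<Rightarrow> real"
  assumes w: "\<And>i. i \<in> E \<Longrightarrow> w i \<ge> 0" and W: "sum w E \<le> 1"
  shows "exp (\<Sum>i\<in>E. w i * x i) \<le> 1 + (\<Sum>i\<in>E. w i * exp (x i))"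
proof -
  define \<mu> where "\<mu> = (\<Sum>i\<in>E. w i * x i)"
  have tangent: "exp \<mu> * (1 + (t - \<mu>)) \<le> exp t" for t
  proof -
    have "exp \<mu> * (1 + (t - \<mu>)) \<le> exp \<mu> * exp (t - \<mu>)" by (intro mult_left_mono exp_ge_add_one_self) auto
    thus ?thesis by (simp flip: exp_add)
  qed
  have "exp \<mu> = (1 - sum w E) * (exp \<mu> * (1 + (0 - \<mu>))) + exp \<mu> * (sum w E + \<mu> - sum w E * \<mu>)"
    by (simp add: algebra_simps)
  also have "sum w E + \<mu> - sum w E * \<mu> = (\<Sum>i\<in>E. w i * (1 + (x i - \<mu>)))"
  proof -
    have "(\<Sum>i\<in>E. w i * (1 + (x i - \<mu>))) = (\<Sum>i\<in>E. w i + w i * x i - w i * \<mu>)"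
      by (intro sum.cong) (auto simp: algebra_simps)
    also have "\<dots> = sum w E + \<mu> - sum w E * \<mu>"
      by (simp add: sum.distrib sum_subtractf \<mu>_def[symmetric] sum_distrib_right)
    finally show ?thesis by simp
  qed
  also have "exp \<mu> * \<dots> = (\<Sum>i\<in>E. w i * (exp \<mu> * (1 + (x i - \<mu>))))"
    by (simp add: sum_distrib_left mult_ac)
  also have "\<dots> \<le> (\<Sum>i\<in>E. w i * exp (x i))" by (intro sum_mono mult_left_mono tangent w)
  also have "(1 - sum w E) * (exp \<mu> * (1 + (0 - \<mu>))) \<le> (1 - sum w E) * exp 0"
    using W by (intro mult_left_mono tangent) auto
  also have "(1 - sum w E) * exp 0 \<le> 1" using w by (simp add: sum_nonneg)
  finally show ?thesis by (simp add: \<mu>_def)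
qed

text \<open>All coordinates except \<open>j\<close> are chosen freely; then at most \<open>B\<close>
  values remain for coordinate \<open>j\<close>.\<close>

lemma card_tuples_relation:
  assumes A: "finite A" and ij: "i < k" "j < k" "i \<noteq> j"
    and B: "\<And>x. x \<in> A \<Longrightarrow> real (card {y \<in> A. R x y}) \<le> B"
  shows "real (card {a \<in> {..<k} \<rightarrow>\<^sub>E A. R (a i) (a j)}) \<le> real (card A) ^ (k - 1) * B"
proof -
  define I where "I = {..<k} - {j}"
  have I: "{..<k} = insert j I" "finite I" "card I = k - 1" "i \<in> I" using ij by (auto simp: I_def)
  define \<Sigma> where "\<Sigma> = (SIGMA g:I \<rightarrow>\<^sub>E A. {y \<in> A. R (g i) y})"
  have finP: "finite (I \<rightarrow>\<^sub>E A)" using I A by (intro finite_PiE) auto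
  have fin: "finite \<Sigma>" unfolding \<Sigma>_def using finP A by auto
  have "{a \<in> {..<k} \<rightarrow>\<^sub>E A. R (a i) (a j)} \<subseteq> (\<lambda>(g, y). g(j := y)) ` \<Sigma>"
  proof
    fix a assume a: "a \<in> {a \<in> {..<k} \<rightarrow>\<^sub>E A. R (a i) (a j)}"
    hence "a \<in> insert j I \<rightarrow>\<^sub>E A" using I by simp
    then obtain y g where yg: "a = g(j := y)" "y \<in> A" "g \<in> I \<rightarrow>\<^sub>E A"
      unfolding PiE_insert_eq by auto
    have "R (g i) y" using a yg ij by simp
    hence "(g, y) \<in> \<Sigma>" using yg by (simp add: \<Sigma>_def)
    thus "a \<in> (\<lambda>(g, y). g(j := y)) ` \<Sigma>" using yg by force
  qed
  hence "card {a \<in> {..<k} \<rightarrow>\<^sub>E A. R (a i) (a j)} \<le> card \<Sigma>"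
    using fin by (meson card_image_le card_mono finite_imageI order_trans)
  also have "card \<Sigma> = (\<Sum>g\<in>I \<rightarrow>\<^sub>E A. card {y \<in> A. R (g i) y})"
    unfolding \<Sigma>_def using finP A by (subst card_SigmaI) auto
  finally have "real (card {a \<in> {..<k} \<rightarrow>\<^sub>E A. R (a i) (a j)}) \<le> (\<Sum>g\<in>I \<rightarrow>\<^sub>E A. real (card {y \<in> A. R (g i) y}))"
    by (simp flip: of_nat_sum)
  also have "\<dots> \<le> (\<Sum>g\<in>I \<rightarrow>\<^sub>E A. B)" using I(4) by (intro sum_mono B) auto
  also have "\<dots> = real (card A) ^ (k - 1) * B" using I by (simp add: card_PiE)
  finally show ?thesis .
qed

lemma real_card_eq_sum:
  "finite U \<Longrightarrow> real (card {u \<in> U. P u}) = (\<Sum>u\<in>U. if P u then 1 else 0)"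
  by (simp add: sum.If_cases Int_def)

lemma sum_power_card_eq:
  fixes Q :: "nat \<Rightarrow> nat \<Rightarrow> bool"
  assumes A: "finite A"
  shows "(\<Sum>m<N. real (card {a \<in> A. Q m a}) ^ k) =
    (\<Sum>a\<in>{..<k} \<rightarrow>\<^sub>E A. real (card {m. m < N \<and> (\<forall>i<k. Q m (a i))}))"
proof -
  have finP: "finite ({..<k} \<rightarrow>\<^sub>E A)" using A by (intro finite_PiE) auto
  have "real (card {a \<in> A. Q m a}) ^ k = (\<Sum>a\<in>{..<k} \<rightarrow>\<^sub>E A. if \<forall>i<k. Q m (a i) then 1 else 0)" for m
  proof -
    have "real (card {a \<in> A. Q m a}) ^ k = real (card ({..<k} \<rightarrow>\<^sub>E {a \<in> A. Q m a}))"
      by (simp add: card_PiE)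
    also have "{..<k} \<rightarrow>\<^sub>E {a \<in> A. Q m a} = {a \<in> {..<k} \<rightarrow>\<^sub>E A. \<forall>i<k. Q m (a i)}"
      by (rule Set.set_eqI) (simp add: PiE_iff, blast)
    also have "real (card \<dots>) = (\<Sum>a\<in>{..<k} \<rightarrow>\<^sub>E A. if \<forall>i<k. Q m (a i) then 1 else 0)"
      by (rule real_card_eq_sum[OF finP])
    finally show ?thesis .
  qed
  hence "(\<Sum>m<N. real (card {a \<in> A. Q m a}) ^ k) =
      (\<Sum>m<N. \<Sum>a\<in>{..<k} \<rightarrow>\<^sub>E A. if \<forall>i<k. Q m (a i) then 1 else 0)" by simp
  also have "\<dots> = (\<Sum>a\<in>{..<k} \<rightarrow>\<^sub>E A. \<Sum>m<N. if \<forall>i<k. Q m (a i) then 1 else 0)" by (rule sum.swap)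
  also have "\<dots> = (\<Sum>a\<in>{..<k} \<rightarrow>\<^sub>E A. real (card {m \<in> {..<N}. \<forall>i<k. Q m (a i)}))"
    by (subst real_card_eq_sum) auto
  finally show ?thesis by simp
qed

text \<open>Every prime factor is at least 2, so \<open>2 ^ card (prime_factors h) \<le> h\<close>;
  the constant 2 comes from \<open>ln 2 \<ge> 1 / 2\<close>.\<close>

lemma card_prime_factors_le:
  fixes h :: nat
  assumes h: "h > 0"
  shows "real (card (prime_factors h)) \<le> 2 * ln (real h)"
proof -
  have "2 ^ card (prime_factors h) = (\<Prod>p\<in>prime_factors h. 2 :: nat)" by simp
  also have "\<dots> \<le> (\<Prod>p\<in>prime_factors h. p ^ multiplicity p h)"
  proof (intro prod_mono conjI)
    fix p assume p: "p \<in> prime_factors h"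
    hence pp: "prime p" by auto
    have "multiplicity p h > 0" using p by (simp add: prime_factors_multiplicity)
    hence "p ^ 1 \<le> p ^ multiplicity p h" using prime_gt_0_nat[OF pp] by (intro power_increasing) auto
    thus "2 \<le> p ^ multiplicity p h" using prime_ge_2_nat[OF pp] by simp
  qed simp
  also have "\<dots> = h" using h by (simp add: prime_factorization_nat[symmetric])
  finally have "real (2 ^ card (prime_factors h)) \<le> real h" by (simp only: of_nat_le_iff)
  hence "ln (2 ^ card (prime_factors h)) \<le> ln (real h)" using h by (intro ln_mono) auto
  hence "real (card (prime_factors h)) * ln 2 \<le> ln (real h)" by (simp add: ln_realpow)
  moreover have "real (card (prime_factors h)) * (1 / 2) \<le> real (card (prime_factors h)) * ln 2"
    using ln2_ge_two_thirds by (intro mult_left_mono) auto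
  ultimately show ?thesis by simp
qed

section \<open>Collision primes of a tuple\<close>

text \<open>For an injective tuple these are the primes dividing some difference
  \<open>a i - a j\<close>, that is, those modulo which the \<open>k\<close> shifts occupy fewer
  than \<open>k\<close> classes. A tuple with a repeated entry has every prime as a collision
  prime.\<close>

definition collision_primes :: "nat \<Rightarrow> (nat \<Rightarrow> nat) \<Rightarrow> nat set" where
  "collision_primes k a = {p. prime p \<and> (\<exists>i<k. \<exists>j<k. i \<noteq> j \<and> a i mod p = a j mod p)}"

definition index_pairs :: "nat \<Rightarrow> (nat \<times> nat) set" where
  "index_pairs k = {(i, j). i < k \<and> j < k \<and> i \<noteq> j}"

lemma index_pairs: "finite (index_pairs k)" "card (index_pairs k) \<le> k\<^sup>2"
proof -
  have sub: "index_pairs k \<subseteq> {..<k} \<times> {..<k}" by (auto simp: index_pairs_def)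
  thus "finite (index_pairs k)" by (rule finite_subset) auto
  have "card (index_pairs k) \<le> card ({..<k} \<times> {..<k})" using sub by (intro card_mono) auto
  thus "card (index_pairs k) \<le> k\<^sup>2" by (simp add: power2_eq_square)
qed

lemma collision_primes:
  assumes inj: "inj_on a {..<k}" and an: "\<And>i. i < k \<Longrightarrow> a i \<le> n" and n: "n \<ge> 1"
  shows "finite (collision_primes k a)"
    and "real (card (collision_primes k a)) \<le> 2 * real k ^ 2 * ln (real n)"
proof -
  define h where "h = (\<lambda>(i, j). if a i \<ge> a j then a i - a j else a j - a i)"
  have h: "h e > 0" "h e \<le> n" if "e \<in> index_pairs k" for e
  proof -
    obtain i j where e: "e = (i, j)" "i < k" "j < k" "i \<noteq> j" using \<open>e \<in> index_pairs k\<close> by (auto simp: index_pairs_def)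
    hence "a i \<noteq> a j" using inj by (auto simp: inj_on_def)
    thus "h e > 0" "h e \<le> n" using e an[of i] an[of j] by (auto simp: h_def)
  qed
  have sub: "collision_primes k a \<subseteq> (\<Union>e\<in>index_pairs k. prime_factors (h e))"
  proof
    fix p assume "p \<in> collision_primes k a"
    then obtain i j where p: "prime p" "i < k" "j < k" "i \<noteq> j" "a i mod p = a j mod p"
      by (auto simp: collision_primes_def)
    have e: "(i, j) \<in> index_pairs k" using p by (auto simp: index_pairs_def)
    have "p dvd h (i, j)"
      using p(5) mod_eq_dvd_iff_nat[of "a j" "a i" p] mod_eq_dvd_iff_nat[of "a i" "a j" p]
      by (auto simp: h_def)
    hence "p \<in> prime_factors (h (i, j))" using h(1)[OF e] p(1) by (simp add: in_prime_factors_iff)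
    thus "p \<in> (\<Union>e\<in>index_pairs k. prime_factors (h e))" using e by blast
  qed
  show "finite (collision_primes k a)"
    by (rule finite_subset[OF sub]) (auto simp: index_pairs)
  have "card (collision_primes k a) \<le> card (\<Union>e\<in>index_pairs k. prime_factors (h e))"
    by (intro card_mono sub) (auto simp: index_pairs)
  also have "\<dots> \<le> (\<Sum>e\<in>index_pairs k. card (prime_factors (h e)))"
    by (rule card_UN_le) (rule index_pairs)
  finally have "real (card (collision_primes k a)) \<le> (\<Sum>e\<in>index_pairs k. real (card (prime_factors (h e))))"
    by (simp flip: of_nat_sum)
  also have "\<dots> \<le> (\<Sum>e\<in>index_pairs k. 2 * ln (real n))"
  proof (rule sum_mono)
    fix e assume e: "e \<in> index_pairs k"
    have "real (card (prime_factors (h e))) \<le> 2 * ln (real (h e))" by (rule card_prime_factors_le[OF h(1)[OF e]])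
    also have "\<dots> \<le> 2 * ln (real n)" using h[OF e] by (intro mult_left_mono ln_mono) auto
    finally show "real (card (prime_factors (h e))) \<le> 2 * ln (real n)" .
  qed
  also have "\<dots> = real (card (index_pairs k)) * (2 * ln (real n))" by simp
  also have "\<dots> \<le> real (k\<^sup>2) * (2 * ln (real n))"
    using index_pairs(2)[of k] n by (intro mult_right_mono of_nat_mono) auto
  finally show "real (card (collision_primes k a)) \<le> 2 * real k ^ 2 * ln (real n)"
    by (simp add: mult_ac)
qed

text \<open>If all \<open>m - a i\<close> are primes above \<open>x\<close>, then \<open>m\<close>
  avoids the classes of the \<open>a i\<close> modulo each \<open>p \<le> x\<close>. Outside
  \<open>D\<close> these are \<open>k\<close> distinct classes, as the sieve requires.\<close>

lemma card_simultaneous_shifts_le: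
  assumes inj: "inj_on a {..<k}" and an: "\<And>i. i < k \<Longrightarrow> a i \<le> n" and n: "n \<ge> 1"
    and k: "k \<ge> 1" and x: "x \<ge> 2" and y: "2 * k \<le> y"
  defines "D \<equiv> primes_upto y \<union> collision_primes k a"
  shows "real (card {m. m < N \<and> (\<forall>i<k. a i \<le> m \<and> m - a i \<in> primes_upto n)})
    \<le> real N * ((\<Prod>p\<in>D. real p / (real p - 1)) / ln (real x)) ^ k
      + real x ^ (6 * k) + real k * (real x + 1)"
proof -
  define M0 where "M0 = {m. m < N \<and> (\<forall>i<k. a i \<le> m \<and> m - a i \<in> primes_upto n)}"
  define M where "M = {m \<in> M0. \<forall>i<k. m - a i > x}"
  define \<Omega> where "\<Omega> = (\<lambda>p. (\<lambda>i. a i mod p) ` {..<k})"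
  have finM0: "finite M0" by (simp add: M0_def)
  hence finM: "finite M" by (simp add: M_def)
  have M: "real (card M) \<le> real N * ((\<Prod>p\<in>D. real p / (real p - 1)) / ln (real x)) ^ k + real x ^ (6 * k)"
  proof (rule sieve_bound[where \<Omega> = \<Omega>, OF x k])
    show "finite D" using collision_primes(1)[OF inj an n] by (simp add: D_def)
    show "prime p" if "p \<in> D" for p using that by (auto simp: D_def primes_upto_def collision_primes_def)
    show "p \<in> D" if "prime p" "p < 2 * k" for p using that y by (auto simp: D_def primes_upto_def)
    show "\<Omega> p \<subseteq> {..<p} \<and> card (\<Omega> p) = k" if p: "p \<in> primes_upto x - D" for p
    proof
      have pp: "prime p" using p by (simp add: primes_upto_def)
      show "\<Omega> p \<subseteq> {..<p}" using prime_gt_0_nat[OF pp] by (auto simp: \<Omega>_def)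
      have "inj_on (\<lambda>i. a i mod p) {..<k}"
        using p pp by (auto simp: inj_on_def D_def collision_primes_def)
      thus "card (\<Omega> p) = k" unfolding \<Omega>_def by (simp add: card_image)
    qed
    show "M \<subseteq> {..<N}" by (auto simp: M_def M0_def)
    show "m mod p \<notin> \<Omega> p" if m: "m \<in> M" and p: "p \<in> primes_upto x - D" for m p
    proof
      assume "m mod p \<in> \<Omega> p"
      then obtain i where i: "i < k" "m mod p = a i mod p" by (auto simp: \<Omega>_def)
      have mi: "a i \<le> m" "prime (m - a i)" "m - a i > x"
        using m i by (auto simp: M_def M0_def primes_upto_def)
      have "p dvd m - a i" using i mi by (simp add: mod_eq_dvd_iff_nat)
      hence "p = 1 \<or> p = m - a i" using mi(2) by (simp add: prime_nat_iff)
      thus False using p mi(3) by (auto simp: primes_upto_def)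
    qed
  qed
  \<comment> \<open>The sieve misses those \<open>m\<close> for which some \<open>m - a i\<close> is
    at most \<open>x\<close>; they lie in \<open>k\<close> intervals of \<open>x + 1\<close>
    integers.\<close>
  have "M0 \<subseteq> M \<union> (\<Union>i<k. {a i..a i + x})"
  proof
    fix m assume m: "m \<in> M0"
    show "m \<in> M \<union> (\<Union>i<k. {a i..a i + x})"
    proof (cases "m \<in> M")
      case False
      then obtain i where i: "i < k" "m - a i \<le> x" using m by (auto simp: M_def not_less)
      have "a i \<le> m" using m i by (simp add: M0_def)
      hence "m \<in> {a i..a i + x}" using i by auto
      thus ?thesis using i by blast
    qed simp
  qed
  hence "card M0 \<le> card (M \<union> (\<Union>i<k. {a i..a i + x}))" using finM by (intro card_mono) auto
  also have "\<dots> \<le> card M + card (\<Union>i<k. {a i..a i + x})" by (rule card_Un_le)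
  also have "card (\<Union>i<k. {a i..a i + x}) \<le> (\<Sum>i<k. card {a i..a i + x})" by (rule card_UN_le) simp
  also have "\<dots> = k * (x + 1)" by simp
  finally have "real (card M0) \<le> real (card M + k * (x + 1))" by (simp only: of_nat_le_iff)
  thus ?thesis using M unfolding M0_def[symmetric] by (simp add: algebra_simps)
qed

text \<open>Collision primes above \<open>z\<close> are bounded for every tuple: there are at most
  \<open>2 * k ^ 2 * ln n\<close> of them, each with local factor at most
  \<open>exp (2 / z)\<close>. Those between \<open>y\<close> and \<open>z\<close> stay in the
  exponent, to be averaged over tuples.\<close>

lemma prod_collision_primes_le:
  fixes y z :: nat
  assumes inj: "inj_on a {..<k}" and an: "\<And>i. i < k \<Longrightarrow> a i \<le> n" and n: "n \<ge> 1" and z: "z \<ge> 1"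
  shows "(\<Prod>p\<in>primes_upto y \<union> collision_primes k a. real p / (real p - 1)) ^ k
    \<le> (\<Prod>p\<in>primes_upto y. real p / (real p - 1)) ^ k * exp (4 * real k ^ 3 * ln (real n) / real z)
      * exp (\<Sum>p | p \<in> collision_primes k a \<and> y < p \<and> p \<le> z. 2 * real k / real p)"
proof -
  define f where "f = (\<lambda>p::nat. real p / (real p - 1))"
  define C where "C = collision_primes k a"
  define C1 where "C1 = {p. p \<in> C \<and> y < p \<and> p \<le> z}"
  define C2 where "C2 = {p. p \<in> C \<and> y < p \<and> z < p}"
  have finC: "finite C" and cardC: "real (card C) \<le> 2 * real k ^ 2 * ln (real n)"
    unfolding C_def using collision_primes[OF inj an n] by auto
  have fin: "finite C1" "finite C2" using finC by (auto simp: C1_def C2_def)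
  have pr: "prime p" if "p \<in> C" for p using that by (simp add: C_def collision_primes_def)
  have pr': "prime p" if "p \<in> primes_upto y" for p using that by (simp add: primes_upto_def)
  have un: "primes_upto y \<union> C = primes_upto y \<union> (C1 \<union> C2)"
    using pr by (auto simp: C1_def C2_def primes_upto_def)
  have f1: "1 \<le> f p" "f p \<le> exp (2 / real p)" if "prime p" for p
    using prime_ratio_bounds[OF that] by (auto simp: f_def)
  have pf: "prod f X \<le> exp (\<Sum>p\<in>X. 2 / real p)" "1 \<le> prod f X" if "finite X" "\<And>p. p \<in> X \<Longrightarrow> prime p" for X
  proof -
    have "prod f X \<le> (\<Prod>p\<in>X. exp (2 / real p))"
      using f1 that by (intro prod_mono) (auto intro: order_trans[of 0 1])
    thus "prod f X \<le> exp (\<Sum>p\<in>X. 2 / real p)" using that by (simp add: exp_sum)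
    show "1 \<le> prod f X" using f1 that by (intro prod_ge_1) auto
  qed
  have "(\<Sum>p\<in>C2. 2 / real p) \<le> (\<Sum>p\<in>C2. 2 / real z)"
    using z by (intro sum_mono divide_left_mono) (auto simp: C2_def)
  also have "\<dots> = real (card C2) * (2 / real z)" by simp
  also have "\<dots> \<le> (2 * real k ^ 2 * ln (real n)) * (2 / real z)"
  proof (rule mult_right_mono)
    have "card C2 \<le> card C" by (intro card_mono finC) (auto simp: C2_def)
    thus "real (card C2) \<le> 2 * real k ^ 2 * ln (real n)" using cardC by linarith
  qed auto
  finally have s2: "(\<Sum>p\<in>C2. 2 / real p) \<le> 4 * real k ^ 2 * ln (real n) / real z" by simp
  have "prod f (primes_upto y \<union> C) = prod f (primes_upto y) * (prod f C1 * prod f C2)"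
  proof -
    have "primes_upto y \<inter> (C1 \<union> C2) = {}" "C1 \<inter> C2 = {}"
      by (auto simp: C1_def C2_def primes_upto_def)
    thus ?thesis unfolding un using fin by (simp add: prod.union_disjoint)
  qed
  also have "\<dots> \<le> prod f (primes_upto y) * (exp (\<Sum>p\<in>C1. 2 / real p) * exp (4 * real k ^ 2 * ln (real n) / real z))"
  proof (intro mult_left_mono mult_mono)
    show "prod f C1 \<le> exp (\<Sum>p\<in>C1. 2 / real p)" by (rule pf(1)[OF fin(1)]) (simp add: C1_def pr)
    have "prod f C2 \<le> exp (\<Sum>p\<in>C2. 2 / real p)" by (rule pf(1)[OF fin(2)]) (simp add: C2_def pr)
    also have "\<dots> \<le> exp (4 * real k ^ 2 * ln (real n) / real z)" using s2 by simp
    finally show "prod f C2 \<le> exp (4 * real k ^ 2 * ln (real n) / real z)" .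
    have "1 \<le> prod f C2" by (rule pf(2)[OF fin(2)]) (simp add: C2_def pr)
    thus "0 \<le> prod f C2" by simp
    have "1 \<le> prod f (primes_upto y)" using pf pr' by auto
    thus "0 \<le> prod f (primes_upto y)" by simp
  qed auto
  finally have le: "prod f (primes_upto y \<union> C)
    \<le> prod f (primes_upto y) * (exp (\<Sum>p\<in>C1. 2 / real p) * exp (4 * real k ^ 2 * ln (real n) / real z))" .
  have "1 \<le> prod f (primes_upto y \<union> C)" by (rule pf(2)) (use finC pr pr' in auto)
  hence "prod f (primes_upto y \<union> C) ^ k
    \<le> (prod f (primes_upto y) * (exp (\<Sum>p\<in>C1. 2 / real p) * exp (4 * real k ^ 2 * ln (real n) / real z))) ^ k"
    by (intro power_mono le) auto
  also have "\<dots> = prod f (primes_upto y) ^ k * exp (real k * (4 * real k ^ 2 * ln (real n) / real z))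
      * exp (real k * (\<Sum>p\<in>C1. 2 / real p))"
    by (simp only: power_mult_distrib exp_of_nat_mult mult_ac)
  also have "real k * (4 * real k ^ 2 * ln (real n) / real z) = 4 * real k ^ 3 * ln (real n) / real z"
    by (simp add: power3_eq_cube power2_eq_square)
  also have "real k * (\<Sum>p\<in>C1. 2 / real p) = (\<Sum>p\<in>C1. 2 * real k / real p)"
    by (simp add: sum_distrib_left mult_ac)
  finally show ?thesis unfolding f_def C1_def C_def .
qed

text \<open>The weights \<open>4 k / (p ln p)\<close> have total mass at most \<open>1\<close>, while the exponents they leave over are
  only \<open>ln p / 2\<close>. Jensen's inequality therefore replaces the product over collision primes by a sum that
  can be averaged one prime at a time.\<close>

lemma exp_sum_collision_primes_le:
  fixes y z :: nat
  assumes tail: "4 * real k ^ 3 * (\<Sum>p | prime p \<and> y < p \<and> p \<le> z. 1 / (real p * ln (real p))) \<le> 1"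
  shows "exp (\<Sum>p | p \<in> collision_primes k a \<and> y < p \<and> p \<le> z. 2 * real k / real p)
    \<le> 1 + (\<Sum>(i, j)\<in>index_pairs k. \<Sum>p | prime p \<and> y < p \<and> p \<le> z.
             if a i mod p = a j mod p then 4 * real k / (real p * ln (real p)) * sqrt (real p) else 0)"
proof -
  define P where "P = {p. prime p \<and> y < p \<and> p \<le> z}"
  have finP: "finite P" unfolding P_def by (rule finite_primes_between)
  have P2: "real p \<ge> 2" if "p \<in> P" for p using that prime_ge_2_nat[of p] by (simp add: P_def)
  define w where "w = (\<lambda>p::nat. 4 * real k / (real p * ln (real p)))"
  have w0: "w p \<ge> 0" if "p \<in> P" for p using P2[OF that] by (simp add: w_def)
  \<comment> \<open>A prime is listed once for each pair that collides modulo it. The repetitions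
    only enlarge the exponent, and the resulting sum splits over pairs.\<close>
  define E where "E = {u \<in> index_pairs k \<times> P. a (fst (fst u)) mod snd u = a (snd (fst u)) mod snd u}"
  have Esub: "E \<subseteq> index_pairs k \<times> P" by (auto simp: E_def)
  have finIP: "finite (index_pairs k \<times> P)" using index_pairs(1) finP by simp
  have finE: "finite E" using Esub finIP by (rule finite_subset)
  \<comment> \<open>At most \<open>k ^ 2\<close> pairs times the weight
    \<open>4 * k / (p * ln p)\<close>: this is the origin of \<open>4 * k ^ 3\<close> in the
    assumption on the tail.\<close>
  have W: "(\<Sum>(e, p)\<in>E. w p) \<le> 1"
  proof -
    have "(\<Sum>(e, p)\<in>E. w p) \<le> (\<Sum>(e, p)\<in>index_pairs k \<times> P. w p)"
      using w0 by (intro sum_mono2 finIP Esub) auto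
    also have "\<dots> = real (card (index_pairs k)) * sum w P"
      by (subst sum.cartesian_product[symmetric]) simp
    also have "\<dots> \<le> real (k\<^sup>2) * sum w P"
      using w0 index_pairs(2)[of k] by (intro mult_right_mono of_nat_mono sum_nonneg) auto
    also have "sum w P = 4 * real k * (\<Sum>p\<in>P. 1 / (real p * ln (real p)))"
      by (simp add: w_def sum_distrib_left)
    also have "real (k\<^sup>2) * \<dots> = 4 * real k ^ 3 * (\<Sum>p\<in>P. 1 / (real p * ln (real p)))"
      by (simp add: power2_eq_square power3_eq_cube)
    also have "\<dots> \<le> 1" using tail by (simp add: P_def)
    finally show ?thesis .
  qed
  let ?C = "{p. p \<in> collision_primes k a \<and> y < p \<and> p \<le> z}"
  have "(\<Sum>p\<in>?C. 2 * real k / real p) \<le> (\<Sum>(e, p)\<in>E. 2 * real k / real p)"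
  proof -
    have Csub: "?C \<subseteq> snd ` E"
    proof
      fix p assume p: "p \<in> ?C"
      then obtain i j where ij: "i < k" "j < k" "i \<noteq> j" "a i mod p = a j mod p" "prime p"
        by (auto simp: collision_primes_def)
      hence "((i, j), p) \<in> E" using p by (auto simp: E_def index_pairs_def P_def)
      thus "p \<in> snd ` E" by force
    qed
    have "(\<Sum>p\<in>?C. 2 * real k / real p) \<le> (\<Sum>p\<in>snd ` E. 2 * real k / real p)"
      using finE Csub by (intro sum_mono2) auto
    also have "\<dots> \<le> (\<Sum>u\<in>E. 2 * real k / real (snd u))"
      using finE by (intro sum_image_le[of E "\<lambda>p. 2 * real k / real p" snd, unfolded comp_def]) auto
    finally show ?thesis by (simp add: case_prod_beta)
  qed
  also have "\<dots> = (\<Sum>u\<in>E. w (snd u) * (ln (real (snd u)) / 2))"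
  proof (intro sum.cong refl)
    fix u assume "u \<in> E"
    hence "real (snd u) \<ge> 2" using Esub P2 by auto
    hence "ln (real (snd u)) \<noteq> 0" "real (snd u) \<noteq> 0" by auto
    thus "(case u of (e, p) \<Rightarrow> 2 * real k / real p) = w (snd u) * (ln (real (snd u)) / 2)"
      by (simp add: w_def case_prod_beta)
  qed
  finally have "exp (\<Sum>p\<in>?C. 2 * real k / real p) \<le> exp (\<Sum>u\<in>E. w (snd u) * (ln (real (snd u)) / 2))" by simp
  also have "\<dots> \<le> 1 + (\<Sum>u\<in>E. w (snd u) * exp (ln (real (snd u)) / 2))"
    using W w0 Esub by (intro exp_weighted_sum_le) (auto simp: case_prod_beta)
  also have "(\<Sum>u\<in>E. w (snd u) * exp (ln (real (snd u)) / 2)) = (\<Sum>u\<in>E. w (snd u) * sqrt (real (snd u)))"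
  proof (intro sum.cong refl)
    fix u assume "u \<in> E"
    hence "real (snd u) \<ge> 2" using Esub P2 by auto
    hence "exp (ln (real (snd u)) / 2) = sqrt (real (snd u))"
      by (simp add: ln_sqrt[symmetric])
    thus "w (snd u) * exp (ln (real (snd u)) / 2) = w (snd u) * sqrt (real (snd u))" by simp
  qed
  also have "\<dots> = (\<Sum>u\<in>index_pairs k \<times> P. if a (fst (fst u)) mod snd u = a (snd (fst u)) mod snd u
      then w (snd u) * sqrt (real (snd u)) else 0)"
    unfolding E_def by (rule sum.inter_filter[OF finIP])
  also have "\<dots> = (\<Sum>e\<in>index_pairs k. \<Sum>p\<in>P. if a (fst e) mod p = a (snd e) mod p
      then w p * sqrt (real p) else 0)"
    unfolding sum.cartesian_product case_prod_beta ..
  finally show ?thesis unfolding P_def w_def case_prod_beta .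
qed

text \<open>Injective tuples go through the sieve, which gives \<open>Z * G a + K\<close>; those
  with a repeated entry are few and are counted with the trivial bound \<open>2 * n + 1\<close>. In
  the average of \<open>G\<close> two coordinates agree modulo \<open>p\<close> for at most a
  proportion \<open>\<beta> / (p * card A)\<close> of the tuples. The weight \<open>sqrt p\<close>
  thus becomes \<open>1 / sqrt p\<close>, which saves \<open>sqrt (2 ^ J)\<close> as
  \<open>p\<close> exceeds \<open>2 ^ J\<close>.\<close>

lemma moment_bound:
  fixes A :: "nat set" and n k J x z :: nat
  assumes A: "A \<subseteq> primes_upto n" and n: "n \<ge> 1" and k: "k \<ge> 1" and x: "x \<ge> 2" and z: "z \<ge> 1"
    and J: "2 * k \<le> 2 ^ J"
    and tail: "4 * real k ^ 3 * (\<Sum>p | prime p \<and> 2 ^ J < p \<and> p \<le> z. 1 / (real p * ln (real p))) \<le> 1"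
    and BT: "\<And>p r. prime p \<Longrightarrow> p \<le> z \<Longrightarrow> real (card {q \<in> primes_upto n. q mod p = r}) \<le> \<beta> / real p"
    and big: "4 * real k ^ 3 * ln (real n) \<le> real z" and beta: "\<beta> \<ge> 0"
  defines "V \<equiv> \<Prod>p\<in>primes_upto (2 ^ J). real p / (real p - 1)"
  shows "(\<Sum>m<2 * n + 1. real (card {a \<in> A. a \<le> m \<and> m - a \<in> primes_upto n}) ^ k)
    \<le> real (2 * n + 1) * (V / ln (real x)) ^ k * exp 1
         * (real (card A) ^ k + real (card A) ^ (k - 1) * (\<beta> / sqrt (2 ^ J)))
       + real (card A) ^ k * (real x ^ (6 * k) + real k * (real x + 1))
       + real k ^ 2 * real (card A) ^ (k - 1) * real (2 * n + 1)"
proof -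
  define T where "T = ({..<k} \<rightarrow>\<^sub>E A)"
  define N where "N = 2 * n + 1"
  define F where "F = (\<lambda>a. real (card {m. m < N \<and> (\<forall>i<k. a i \<le> m \<and> m - a i \<in> primes_upto n)}))"
  define y :: nat where "y = 2 ^ J"
  define P where "P = {p. prime p \<and> y < p \<and> p \<le> z}"
  define w where "w = (\<lambda>p::nat. 4 * real k / (real p * ln (real p)))"
  define G where "G = (\<lambda>a :: nat \<Rightarrow> nat. 1 + (\<Sum>(i, j)\<in>index_pairs k. \<Sum>p\<in>P.
             if a i mod p = a j mod p then w p * sqrt (real p) else 0))"
  define K where "K = real x ^ (6 * k) + real k * (real x + 1)"
  have finA: "finite A" using A finite_subset finite_primes_upto by blast
  have finT: "finite T" unfolding T_def using finA by (intro finite_PiE) auto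
  have cardT: "card T = card A ^ k" unfolding T_def by (simp add: card_PiE)
  have finP: "finite P" unfolding P_def by (rule finite_primes_between)
  have P2: "real p \<ge> 2" if "p \<in> P" for p using that prime_ge_2_nat[of p] by (simp add: P_def)
  have w0: "w p \<ge> 0" if "p \<in> P" for p using P2[OF that] by (simp add: w_def)
  have lx: "ln (real x) > 0" using x by simp
  have V0: "V \<ge> 0" unfolding V_def using prime_ratio_bounds(1)
    by (intro prod_nonneg) (auto simp: primes_upto_def intro: order_trans[of 0 1])
  have K0: "K \<ge> 0" by (simp add: K_def)
  \<comment> \<open>The factor \<open>exp 1\<close> is the contribution of the collision primes
    above \<open>z\<close>, whose exponent is at most 1 by the assumption
    \<open>big\<close>.\<close>
  define Z where "Z = real N * (V / ln (real x)) ^ k * exp 1"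
  have Z0: "Z \<ge> 0" unfolding Z_def using V0 lx by simp
  have G1: "G a \<ge> 0" for a
  proof -
    have "0 \<le> (\<Sum>(i, j)\<in>index_pairs k. \<Sum>p\<in>P. if a i mod p = a j mod p then w p * sqrt (real p) else 0)"
      using w0 by (intro sum_nonneg) (auto intro!: sum_nonneg)
    thus ?thesis by (simp add: G_def)
  qed
  have injF: "F a \<le> Z * G a + K" if a: "a \<in> T" and inj: "inj_on a {..<k}" for a
  proof -
    have an: "a i \<le> n" if "i < k" for i
      using a that A by (auto simp: T_def PiE_iff primes_upto_def)
    let ?D = "\<Prod>p\<in>primes_upto y \<union> collision_primes k a. real p / (real p - 1)"
    have "F a \<le> real N * (?D / ln (real x)) ^ k + real x ^ (6 * k) + real k * (real x + 1)"
      unfolding F_def using J by (intro card_simultaneous_shifts_le[OF inj an n k x]) (auto simp: y_def)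
    also have "real N * (?D / ln (real x)) ^ k = real N * (?D ^ k / ln (real x) ^ k)"
      by (simp add: power_divide)
    also have "\<dots> \<le> real N * ((V ^ k * exp 1 * G a) / ln (real x) ^ k)"
    proof (intro mult_left_mono divide_right_mono)
      have "?D ^ k \<le> V ^ k * exp (4 * real k ^ 3 * ln (real n) / real z)
        * exp (\<Sum>p | p \<in> collision_primes k a \<and> y < p \<and> p \<le> z. 2 * real k / real p)"
        unfolding V_def y_def by (rule prod_collision_primes_le[OF inj an n z])
      also have "\<dots> \<le> V ^ k * exp 1 * G a"
      proof (intro mult_mono)
        show "exp (4 * real k ^ 3 * ln (real n) / real z) \<le> exp 1" using big z by simp
        show "exp (\<Sum>p | p \<in> collision_primes k a \<and> y < p \<and> p \<le> z. 2 * real k / real p) \<le> G a"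
          unfolding G_def w_def P_def
          by (rule exp_sum_collision_primes_le) (use tail in \<open>simp add: y_def\<close>)
      qed (use V0 in auto)
      finally show "?D ^ k \<le> V ^ k * exp 1 * G a" .
    qed (use lx in auto)
    also have "\<dots> = Z * G a" by (simp add: Z_def power_divide)
    finally show ?thesis by (simp add: K_def)
  qed
  define Tb where "Tb = {a \<in> T. \<not> inj_on a {..<k}}"
  have FN: "F a \<le> real N" for a
  proof -
    have "card {m. m < N \<and> (\<forall>i<k. a i \<le> m \<and> m - a i \<in> primes_upto n)} \<le> card {..<N}"
      by (intro card_mono) auto
    thus ?thesis by (simp add: F_def)
  qed
  have cardTb: "real (card Tb) \<le> real k ^ 2 * real (card A) ^ (k - 1)"
  proof -
    have "Tb \<subseteq> (\<Union>(i, j)\<in>index_pairs k. {a \<in> T. a i = a j})"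
      by (auto simp: Tb_def inj_on_def index_pairs_def)
    hence "card Tb \<le> card (\<Union>(i, j)\<in>index_pairs k. {a \<in> T. a i = a j})"
      using finT index_pairs(1) by (intro card_mono) auto
    also have "\<dots> \<le> (\<Sum>e\<in>index_pairs k. card (case e of (i, j) \<Rightarrow> {a \<in> T. a i = a j}))"
      by (rule card_UN_le) (rule index_pairs)
    finally have "real (card Tb) \<le> (\<Sum>e\<in>index_pairs k. real (card (case e of (i, j) \<Rightarrow> {a \<in> T. a i = a j})))"
      by (simp flip: of_nat_sum)
    also have "\<dots> \<le> (\<Sum>e\<in>index_pairs k. real (card A) ^ (k - 1) * 1)"
    proof (rule sum_mono)
      fix e assume "e \<in> index_pairs k"
      then obtain i j where e: "e = (i, j)" "i < k" "j < k" "i \<noteq> j" by (auto simp: index_pairs_def)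
      have "real (card {a \<in> T. a i = a j}) \<le> real (card A) ^ (k - 1) * 1"
        unfolding T_def
      proof (rule card_tuples_relation[OF finA e(2-4), where R = "(=)"])
        fix u assume "u \<in> A"
        hence "{v \<in> A. u = v} = {u}" by auto
        thus "real (card {v \<in> A. u = v}) \<le> 1" by simp
      qed
      thus "real (card (case e of (i, j) \<Rightarrow> {a \<in> T. a i = a j})) \<le> real (card A) ^ (k - 1) * 1"
        by (simp add: e)
    qed
    also have "\<dots> = real (card (index_pairs k)) * real (card A) ^ (k - 1)" by simp
    also have "\<dots> \<le> real (k\<^sup>2) * real (card A) ^ (k - 1)"
      using index_pairs(2)[of k] by (intro mult_right_mono of_nat_mono) auto
    finally show ?thesis by simp
  qed
  have sumG: "sum G T \<le> real (card A) ^ k + real (card A) ^ (k - 1) * (\<beta> / sqrt (2 ^ J))"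
  proof -
    let ?c = "real (card A) ^ (k - 1)"
    have "(\<Sum>a\<in>T. \<Sum>(i, j)\<in>index_pairs k. \<Sum>p\<in>P. if a i mod p = a j mod p then w p * sqrt (real p) else 0)
        = (\<Sum>e\<in>index_pairs k. \<Sum>p\<in>P. \<Sum>a\<in>T. if a (fst e) mod p = a (snd e) mod p then w p * sqrt (real p) else 0)"
      by (subst sum.swap, simp add: case_prod_beta, intro sum.cong refl, rule sum.swap)
    also have "\<dots> \<le> (\<Sum>e\<in>index_pairs k. \<Sum>p\<in>P. ?c * (w p * (\<beta> / sqrt (2 ^ J))))"
    proof (intro sum_mono)
      fix e p assume "e \<in> index_pairs k" and p: "p \<in> P"
      then obtain i j where e: "e = (i, j)" "i < k" "j < k" "i \<noteq> j" by (auto simp: index_pairs_def)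
      have pp: "prime p" "p \<le> z" "y < p" using p by (auto simp: P_def)
      have p0: "real p > 0" using P2[OF p] by simp
      have "(\<Sum>a\<in>T. if a i mod p = a j mod p then w p * sqrt (real p) else 0)
          = w p * sqrt (real p) * real (card {a \<in> T. a i mod p = a j mod p})"
        using finT by (simp add: real_card_eq_sum sum_distrib_left if_distrib cong: if_cong)
      also have "\<dots> \<le> w p * sqrt (real p) * (?c * (\<beta> / real p))"
      proof (rule mult_left_mono)
        show "real (card {a \<in> T. a i mod p = a j mod p}) \<le> ?c * (\<beta> / real p)"
          unfolding T_def
        proof (rule card_tuples_relation[OF finA e(2-4), where R = "\<lambda>u v. u mod p = v mod p"])
          fix u assume "u \<in> A"
          have "card {v \<in> A. u mod p = v mod p} \<le> card {q \<in> primes_upto n. q mod p = u mod p}"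
            using A by (intro card_mono) auto
          thus "real (card {v \<in> A. u mod p = v mod p}) \<le> \<beta> / real p"
            using BT[OF pp(1,2), of "u mod p"] by linarith
        qed
      qed (use w0[OF p] in auto)
      also have "\<dots> = ?c * (w p * (\<beta> / sqrt (real p)))"
        using p0 real_sqrt_mult_self[of "real p"] by (simp add: field_simps)
      also have "\<dots> \<le> ?c * (w p * (\<beta> / sqrt (2 ^ J)))"
      proof (intro mult_left_mono divide_left_mono)
        have "real y \<le> real p" using pp by simp
        thus "sqrt (2 ^ J) \<le> sqrt (real p)" by (simp add: y_def)
      qed (use w0[OF p] beta p0 in auto)
      finally show "(\<Sum>a\<in>T. if a (fst e) mod p = a (snd e) mod p then w p * sqrt (real p) else 0)
          \<le> ?c * (w p * (\<beta> / sqrt (2 ^ J)))" by (simp add: e)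
    qed
    \<comment> \<open>What remains is the total mass of the weights, at most 1 for the same reason
      as in Jensen's inequality.\<close>
    also have "\<dots> = ?c * (\<beta> / sqrt (2 ^ J)) * (real (card (index_pairs k)) * sum w P)"
      by (simp add: sum_distrib_left sum_distrib_right sum_divide_distrib mult_ac)
    also have "\<dots> \<le> ?c * (\<beta> / sqrt (2 ^ J)) * 1"
    proof (rule mult_left_mono)
      have "real (card (index_pairs k)) * sum w P \<le> real (k\<^sup>2) * sum w P"
        using w0 index_pairs(2)[of k] by (intro mult_right_mono of_nat_mono sum_nonneg) auto
      also have "sum w P = 4 * real k * (\<Sum>p\<in>P. 1 / (real p * ln (real p)))"
        by (simp add: w_def sum_distrib_left)
      also have "real (k\<^sup>2) * \<dots> = 4 * real k ^ 3 * (\<Sum>p\<in>P. 1 / (real p * ln (real p)))"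
        by (simp add: power2_eq_square power3_eq_cube)
      also have "\<dots> \<le> 1" using tail by (simp add: P_def y_def)
      finally show "real (card (index_pairs k)) * sum w P \<le> 1" by (simp add: w_def sum_distrib_left)
    qed (use beta in auto)
    finally show ?thesis by (simp add: G_def sum.distrib cardT)
  qed
  have "(\<Sum>m<N. real (card {a \<in> A. a \<le> m \<and> m - a \<in> primes_upto n}) ^ k) = sum F T"
    unfolding F_def T_def by (rule sum_power_card_eq[OF finA])
  also have "\<dots> = sum F Tb + sum F (T - Tb)"
    using finT by (subst add.commute, intro sum.subset_diff) (auto simp: Tb_def)
  also have "sum F Tb \<le> (\<Sum>a\<in>Tb. real N)" by (intro sum_mono FN)
  also have "\<dots> = real (card Tb) * real N" by simp
  also have "\<dots> \<le> real k ^ 2 * real (card A) ^ (k - 1) * real N" by (intro mult_right_mono cardTb) auto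
  also have "sum F (T - Tb) \<le> (\<Sum>a\<in>T - Tb. Z * G a + K)" by (intro sum_mono injF) (auto simp: Tb_def)
  also have "\<dots> \<le> (\<Sum>a\<in>T. Z * G a + K)"
    using finT Z0 G1 K0 by (intro sum_mono2) auto
  also have "\<dots> = Z * sum G T + real (card A) ^ k * K"
    by (simp add: sum.distrib sum_distrib_left cardT)
  also have "Z * sum G T \<le> Z * (real (card A) ^ k + real (card A) ^ (k - 1) * (\<beta> / sqrt (2 ^ J)))"
    by (intro mult_left_mono sumG Z0)
  finally show ?thesis by (simp add: N_def Z_def K_def)
qed

section \<open>The sumset\<close>

lemma power_sum_le_card_power:
  fixes r :: "'a \<Rightarrow> real"
  assumes S: "finite S" and r: "\<And>m. m \<in> S \<Longrightarrow> r m \<ge> 0" and k: "k \<ge> 1"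
  shows "(\<Sum>m\<in>S. r m) ^ k \<le> real (card S) ^ (k - 1) * (\<Sum>m\<in>S. r m ^ k)"
proof (cases "S = {}")
  case False
  define s where "s = real (card S)"
  have s0: "s > 0" using False S by (simp add: s_def card_gt_0_iff)
  have conv: "convex_on {0..} (\<lambda>x::real. x ^ k)"
  proof (cases "even k")
    case True
    thus ?thesis using convex_power_even convex_on_subset by blast
  next
    case False
    thus ?thesis by (rule convex_power_odd)
  qed
  have "(\<Sum>m\<in>S. (1 / s) *\<^sub>R r m) ^ k \<le> (\<Sum>m\<in>S. (1 / s) * r m ^ k)"
    using S False s0 r by (intro convex_on_sum[OF S False conv]) (auto simp: s_def)
  hence "((\<Sum>m\<in>S. r m) / s) ^ k \<le> (\<Sum>m\<in>S. r m ^ k) / s"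
    by (simp add: sum_divide_distrib)
  hence "(\<Sum>m\<in>S. r m) ^ k \<le> s ^ k * ((\<Sum>m\<in>S. r m ^ k) / s)"
    using s0 by (simp add: power_divide divide_le_eq mult.commute)
  also have "\<dots> = s ^ (k - 1) * (\<Sum>m\<in>S. r m ^ k)"
    using s0 k by (cases k) auto
  finally show ?thesis by (simp add: s_def)
qed (use k in \<open>simp add: power_0_left\<close>)

text \<open>A pair is recorded by its sum and its first entry. Of the second entry only primality is
  kept, not membership in \<open>A\<close>; a condition of this kind is what the sieve can
  exploit.\<close>

lemma card_power2_le_representations:
  assumes A: "A \<subseteq> primes_upto n"
  shows "(real (card A))\<^sup>2 \<le> (\<Sum>m\<in>A + A. real (card {a \<in> A. a \<le> m \<and> m - a \<in> primes_upto n}))"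
proof -
  have finA: "finite A" using A finite_subset finite_primes_upto by blast
  define R where "R = (\<lambda>m. {a \<in> A. a \<le> m \<and> m - a \<in> primes_upto n})"
  have finAA: "finite (A + A)" using finA by (simp add: finite_set_plus)
  have "card (A \<times> A) \<le> card (SIGMA m:A + A. R m)"
  proof (rule card_inj_on_le)
    show "inj_on (\<lambda>(a, b). (a + b, a)) (A \<times> A)" by (auto simp: inj_on_def)
    show "(\<lambda>(a, b). (a + b, a)) ` (A \<times> A) \<subseteq> (SIGMA m:A + A. R m)"
      using A by (auto simp: R_def)
    show "finite (SIGMA m:A + A. R m)" using finA finAA by (auto simp: R_def)
  qed
  also have "\<dots> = (\<Sum>m\<in>A + A. card (R m))" using finA finAA by (subst card_SigmaI) (auto simp: R_def)
  finally have "real (card A * card A) \<le> real (\<Sum>m\<in>A + A. card (R m))"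
    by (simp only: of_nat_le_iff card_cartesian_product)
  thus ?thesis by (simp add: power2_eq_square R_def)
qed

text \<open>The power mean inequality leaves
  \<open>card A ^ k \<le> s ^ (k - 1) * n * (c / l) ^ k\<close>, where \<open>s\<close> is the size
  of the sumset and \<open>l\<close> is \<open>ln n\<close>. The lower bound for
  \<open>card A\<close> cancels the logarithms, so \<open>s\<close> is at least \<open>n\<close>
  times \<open>\<delta> / (4 * c)\<close> to the power \<open>k / (k - 1)\<close>. The assumption
  \<open>exp (- (k - 1)) \<le> \<delta>\<close> says that the excess power of \<delta> costs at most
  a factor e.\<close>

lemma card_sumset_ge_of_moment:
  fixes A :: "nat set" and c \<delta> :: real
  assumes A: "A \<subseteq> primes_upto n" and n: "n \<ge> 2" and k: "k \<ge> 2" and c: "c \<ge> 1"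
    and \<delta>: "\<delta> > 0" "exp (- (real k - 1)) \<le> \<delta>"
    and cA: "real (card A) \<ge> \<delta> * real n / (4 * ln (real n))"
    and mom: "(\<Sum>m<2 * n + 1. real (card {a \<in> A. a \<le> m \<and> m - a \<in> primes_upto n}) ^ k)
      \<le> real (card A) ^ k * real n * (c / ln (real n)) ^ k"
  shows "real (card (A + A)) \<ge> \<delta> * exp (-1) / (4 * c)\<^sup>2 * real n"
proof (rule ccontr)
  assume neg: "\<not> ?thesis"
  define r where "r = (\<lambda>m. real (card {a \<in> A. a \<le> m \<and> m - a \<in> primes_upto n}))"
  define s where "s = real (card (A + A))"
  define l where "l = ln (real n)"
  define \<alpha> where "\<alpha> = real (card A)"
  have l0: "l > 0" using n by (simp add: l_def)
  have n0: "real n > 0" using n by simp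
  have "0 < \<delta> * real n / (4 * l)" using \<delta> n0 l0 by simp
  hence a0: "\<alpha> > 0" and a1: "\<delta> * real n / (4 * l) \<le> \<alpha>"
    using cA by (auto simp: \<alpha>_def l_def)
  have finA: "finite A" using A finite_subset finite_primes_upto by blast
  have finAA: "finite (A + A)" using finA by (simp add: finite_set_plus)
  have sub: "A + A \<subseteq> {..<2 * n + 1}"
  proof
    fix m assume "m \<in> A + A"
    then obtain a b where "m = a + b" "a \<in> A" "b \<in> A" by (auto elim: set_plus_elim)
    moreover from this have "a \<le> n" "b \<le> n" using A by (auto simp: primes_upto_def)
    ultimately show "m \<in> {..<2 * n + 1}" by simp
  qed
  have "(\<alpha>\<^sup>2) ^ k \<le> (\<Sum>m\<in>A + A. r m) ^ k"
    using card_power2_le_representations[OF A] by (intro power_mono) (auto simp: r_def \<alpha>_def)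
  also have "\<dots> \<le> s ^ (k - 1) * (\<Sum>m\<in>A + A. r m ^ k)"
    unfolding s_def using k by (intro power_sum_le_card_power finAA) (auto simp: r_def)
  also have "(\<Sum>m\<in>A + A. r m ^ k) \<le> (\<Sum>m<2 * n + 1. r m ^ k)"
    using sub by (intro sum_mono2) (auto simp: r_def)
  also have "\<dots> \<le> \<alpha> ^ k * real n * (c / l) ^ k" using mom by (simp add: r_def \<alpha>_def l_def)
  finally have "(\<alpha>\<^sup>2) ^ k \<le> s ^ (k - 1) * (\<alpha> ^ k * real n * (c / l) ^ k)"
    by (simp add: mult_left_mono s_def)
  hence "\<alpha> ^ k * \<alpha> ^ k \<le> \<alpha> ^ k * (s ^ (k - 1) * real n * (c / l) ^ k)"
    by (simp add: power2_eq_square power_mult_distrib mult_ac)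
  hence ub: "\<alpha> ^ k \<le> s ^ (k - 1) * real n * (c / l) ^ k" using a0 by simp
  have "(\<delta> * real n / (4 * l)) ^ k \<le> \<alpha> ^ k" using a1 \<delta> n0 l0 by (intro power_mono) auto
  hence "(\<delta> * real n / (4 * c)) ^ k * (c / l) ^ k \<le> s ^ (k - 1) * real n * (c / l) ^ k"
    using ub c by (simp flip: power_mult_distrib)
  hence 1: "(\<delta> * real n / (4 * c)) ^ k \<le> s ^ (k - 1) * real n"
    using c l0 by simp
  have pm: "u ^ (k - 1) * u = u ^ k" for u :: real using k by (intro power_minus_mult) simp
  define t where "t = \<delta> * exp (-1) / (4 * c)\<^sup>2"
  have "s < t * real n" using neg by (simp add: s_def t_def)
  hence "s ^ (k - 1) < (t * real n) ^ (k - 1)" using k by (intro power_strict_mono) (auto simp: s_def)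
  hence "s ^ (k - 1) * real n < (t * real n) ^ (k - 1) * real n" using n0 by simp
  also have "\<dots> = t ^ (k - 1) * real n ^ k"
    using pm[of "real n"] by (simp add: power_mult_distrib)
  also have "\<dots> \<le> (\<delta> / (4 * c)) ^ k * real n ^ k"
  proof (rule mult_right_mono)
    have "t ^ (k - 1) = \<delta> ^ (k - 1) * exp (-1) ^ (k - 1) / ((4 * c)\<^sup>2) ^ (k - 1)"
      by (simp add: t_def power_mult_distrib power_divide)
    also have "exp (-1) ^ (k - 1) = exp (- (real k - 1))"
      using k by (simp add: exp_of_nat_mult[symmetric] of_nat_diff)
    also have "\<delta> ^ (k - 1) * exp (- (real k - 1)) / ((4 * c)\<^sup>2) ^ (k - 1)
        \<le> \<delta> ^ (k - 1) * \<delta> / (4 * c) ^ k"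
    proof (rule frac_le)
      show "\<delta> ^ (k - 1) * exp (- (real k - 1)) \<le> \<delta> ^ (k - 1) * \<delta>"
        using \<delta> by (intro mult_left_mono) auto
      \<comment> \<open>For \<open>k \<ge> 2\<close> the exponent \<open>k / (k - 1)\<close> is at
        most 2, whence the square of \<open>4 * c\<close> in the conclusion.\<close>
      have "(4 * c) ^ k \<le> (4 * c) ^ (2 * (k - 1))" using k c by (intro power_increasing) auto
      thus "(4 * c) ^ k \<le> ((4 * c)\<^sup>2) ^ (k - 1)" by (simp add: power_mult)
    qed (use \<delta> c in auto)
    also have "\<delta> ^ (k - 1) * \<delta> = \<delta> ^ k" by (rule pm)
    finally show "t ^ (k - 1) \<le> (\<delta> / (4 * c)) ^ k" by (simp add: power_divide)
  qed simp
  also have "(\<delta> / (4 * c)) ^ k * real n ^ k = (\<delta> * real n / (4 * c)) ^ k"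
    by (simp flip: power_mult_distrib)
  finally show False using 1 by simp
qed

text \<open>What a large \<open>n\<close> must satisfy for fixed \<open>k\<close> and \<delta>. With
  \<open>x\<close> the floor of \<open>n powr (2 * e)\<close>, the sieve error is at most
  \<open>sqrt n\<close>, and the drop from \<open>2 * e\<close> to \<open>e\<close> pays for the
  floor. The two inequalities on \<open>(ln n)\<^sup>2\<close> concern \<open>z\<close>, its floor.
  The last two put the sieve errors and the tuples with repeated entries below the main
  term.\<close>

lemma eventually_moment_parameters:
  fixes k :: nat and \<delta> :: real
  assumes k: "k \<ge> 1" and \<delta>: "\<delta> > 0"
  defines "e \<equiv> 1 / (24 * real k)"
  shows "eventually (\<lambda>n::nat. real n powr (2 * e) \<ge> 3 \<and> real n powr (2 * e) - 1 \<ge> real n powr e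
    \<and> 4 * real k ^ 3 * ln (real n) \<le> (ln (real n))\<^sup>2 - 1 \<and> (ln (real n))\<^sup>2 \<ge> 2
    \<and> (1 + 2 * real k) * real n powr (1/2) * ln (real n) ^ k \<le> real n
    \<and> 12 * real k ^ 2 * ln (real n) / \<delta> * ln (real n) ^ k \<le> real n) sequentially"
proof -
  have e0: "e > 0" using k by (simp add: e_def)
  have 1: "eventually (\<lambda>n::nat. real n powr (2 * e) \<ge> 3) sequentially" using e0 by real_asymp
  have 2: "eventually (\<lambda>n::nat. real n powr (2 * e) - 1 \<ge> real n powr e) sequentially" using e0 by real_asymp
  have 3: "eventually (\<lambda>n::nat. K * ln (real n) \<le> (ln (real n))\<^sup>2 - 1) sequentially" for K :: real
    by real_asymp
  have 4: "eventually (\<lambda>n::nat. (ln (real n))\<^sup>2 \<ge> 2) sequentially" by real_asymp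
  have 5: "eventually (\<lambda>n::nat. K * real n powr (1/2) * ln (real n) ^ k \<le> real n) sequentially" for K :: real
    by real_asymp
  have 6: "eventually (\<lambda>n::nat. K * ln (real n) / \<delta> * ln (real n) ^ k \<le> real n) sequentially" for K :: real
    using \<delta> by real_asymp
  show ?thesis by (intro eventually_conj 1 2 3 4 5 6)
qed

text \<open>Here \<open>k\<close> and \<open>J\<close> are fixed and \<open>n\<close> grows. Of the
  demands on \<open>J\<close>, \<open>2 * k \<le> 2 ^ J\<close> lets the sieve start,
  \<open>4 * k ^ 3 * B \<le> J\<close> bounds the mass of the weights by 1, and
  \<open>800 / \<delta> \<le> sqrt (2 ^ J)\<close> makes up for the density of
  \<open>A\<close>.\<close>

lemma eventually_card_sumset_ge:
  fixes k J :: nat and \<delta> B :: real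
  assumes k: "k \<ge> 2" and \<delta>: "\<delta> > 0" "exp (- (real k - 1)) \<le> \<delta>"
    and J: "2 * k \<le> 2 ^ J" "800 / \<delta> \<le> sqrt (2 ^ J)" "J \<ge> 1" "4 * real k ^ 3 * B \<le> real J"
    and tail: "\<And>z. (\<Sum>p | prime p \<and> 2 ^ J < p \<and> p \<le> z. 1 / (real p * ln (real p))) \<le> B / real J"
  defines "V \<equiv> \<Prod>p\<in>primes_upto (2 ^ J). real p / (real p - 1)"
  shows "\<exists>n0. \<forall>n\<ge>n0. \<forall>A. A \<subseteq> primes_upto n \<longrightarrow> real (card A) \<ge> \<delta> * real (card (primes_upto n)) \<longrightarrow>
     real (card (A + A)) \<ge> \<delta> * exp (-1) / (4 * (480 * real k * V))\<^sup>2 * real n"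
proof -
  define e where "e = 1 / (24 * real k)"
  obtain N0 where N0: "\<And>n q r. n \<ge> N0 \<Longrightarrow> prime q \<Longrightarrow> real q \<le> (ln (real n))\<^sup>2 \<Longrightarrow>
     real (card {p \<in> primes_upto n. p mod q = r}) \<le> 200 * real n / (real q * ln (real n))"
    using brun_titchmarsh_small_modulus by blast
  have V1: "V \<ge> 1"
    unfolding V_def using prime_ratio_bounds(1) by (intro prod_ge_1) (auto simp: primes_upto_def)
  have k1: "real k \<ge> 1" using k by simp
  have kV: "real k * V \<ge> 1" using k1 V1 mult_mono[of 1 "real k" 1 V] by simp
  have "eventually (\<lambda>n::nat. n \<ge> N0 \<and> n \<ge> 4) sequentially"
    by (intro eventually_conj eventually_ge_at_top)
  moreover have "eventually (\<lambda>n::nat. real n powr (2 * e) \<ge> 3 \<and> real n powr (2 * e) - 1 \<ge> real n powr e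
    \<and> 4 * real k ^ 3 * ln (real n) \<le> (ln (real n))\<^sup>2 - 1 \<and> (ln (real n))\<^sup>2 \<ge> 2
    \<and> (1 + 2 * real k) * real n powr (1/2) * ln (real n) ^ k \<le> real n
    \<and> 12 * real k ^ 2 * ln (real n) / \<delta> * ln (real n) ^ k \<le> real n) sequentially"
    unfolding e_def using k \<delta> by (intro eventually_moment_parameters) auto
  ultimately have "eventually (\<lambda>n. \<forall>A. A \<subseteq> primes_upto n \<longrightarrow> real (card A) \<ge> \<delta> * real (card (primes_upto n)) \<longrightarrow>
     real (card (A + A)) \<ge> \<delta> * exp (-1) / (4 * (480 * real k * V))\<^sup>2 * real n) sequentially"
  proof eventually_elim
    case (elim n)
    note nN = elim(1)[THEN conjunct1] and n4 = elim(1)[THEN conjunct2]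
    have p1: "real n powr (2 * e) \<ge> 3" and p2: "real n powr (2 * e) - 1 \<ge> real n powr e"
      and p3: "4 * real k ^ 3 * ln (real n) \<le> (ln (real n))\<^sup>2 - 1" and p4: "(ln (real n))\<^sup>2 \<ge> 2"
      and p5: "(1 + 2 * real k) * real n powr (1/2) * ln (real n) ^ k \<le> real n"
      and p6: "12 * real k ^ 2 * ln (real n) / \<delta> * ln (real n) ^ k \<le> real n"
      using elim(2) by auto
    define l where "l = ln (real n)"
    define x where "x = nat \<lfloor>real n powr (2 * e)\<rfloor>"
    define z where "z = nat \<lfloor>l\<^sup>2\<rfloor>"
    define \<beta> where "\<beta> = 200 * real n / l"
    define q where "q = real n / l ^ k"
    have n0: "real n > 0" using n4 by simp
    have l0: "l > 0" using n4 by (simp add: l_def)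
    have q0: "q > 0" using n0 l0 by (simp add: q_def)
    have x2: "x \<ge> 2" unfolding x_def using p1 by linarith
    have xu: "real x \<le> real n powr (2 * e)" unfolding x_def by (simp add: of_nat_floor)
    have xl: "real x \<ge> real n powr e" unfolding x_def using p2 by linarith
    have z1: "z \<ge> 1" unfolding z_def l_def using p4 by linarith
    have zu: "real z \<le> l\<^sup>2" unfolding z_def by (simp add: of_nat_floor)
    have zl: "real z \<ge> l\<^sup>2 - 1" unfolding z_def by linarith
    have lnx: "ln (real x) \<ge> l / (24 * real k)"
    proof -
      have "l / (24 * real k) = ln (real n powr e)" using n0 by (simp add: ln_powr l_def e_def)
      also have "\<dots> \<le> ln (real x)" using xl n0 by (intro ln_mono) auto
      finally show ?thesis .
    qed
    have x6: "real x ^ (6 * k) \<le> real n powr (1/2)"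
    proof -
      have "real x ^ (6 * k) \<le> (real n powr (2 * e)) ^ (6 * k)" using xu by (intro power_mono) auto
      also have "\<dots> = real n powr (1/2)" using n0 k by (simp add: powr_power e_def)
      finally show ?thesis .
    qed
    have xk: "real x \<le> real x ^ (6 * k)" using x2 k by (intro self_le_power) auto
    have K: "real x ^ (6 * k) + real k * (real x + 1) \<le> q"
    proof -
      have "real k * (real x + 1) \<le> real k * (2 * real n powr (1/2))"
      proof (rule mult_left_mono)
        have "real x \<ge> 2" using x2 by simp
        thus "real x + 1 \<le> 2 * real n powr (1/2)" using xk x6 by linarith
      qed simp
      hence "real x ^ (6 * k) + real k * (real x + 1) \<le> (1 + 2 * real k) * real n powr (1/2)"
        using x6 by (simp add: algebra_simps)
      also have "\<dots> \<le> q" using p5 l0 unfolding q_def l_def[symmetric] by (simp add: pos_le_divide_eq)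
      finally show ?thesis .
    qed
    show ?case
    proof (intro allI impI)
      fix A assume A: "A \<subseteq> primes_upto n" and dens: "real (card A) \<ge> \<delta> * real (card (primes_upto n))"
      define \<alpha> where "\<alpha> = real (card A)"
      have "\<delta> * (real n / (4 * l)) \<le> \<delta> * real (card (primes_upto n))"
        using chebyshev_lower[OF n4] \<delta> by (intro mult_left_mono) (auto simp: l_def)
      hence al: "\<delta> * real n / (4 * l) \<le> \<alpha>" using dens by (simp add: \<alpha>_def)
      have "0 < \<delta> * real n / (4 * l)" using \<delta> n0 l0 by simp
      hence a0: "\<alpha> > 0" using al by linarith
      have mom0: "(\<Sum>m<2 * n + 1. real (card {a \<in> A. a \<le> m \<and> m - a \<in> primes_upto n}) ^ k)
        \<le> real (2 * n + 1) * (V / ln (real x)) ^ k * exp 1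
             * (\<alpha> ^ k + \<alpha> ^ (k - 1) * (\<beta> / sqrt (2 ^ J)))
           + \<alpha> ^ k * (real x ^ (6 * k) + real k * (real x + 1))
           + real k ^ 2 * \<alpha> ^ (k - 1) * real (2 * n + 1)"
        unfolding V_def \<alpha>_def
      proof (rule moment_bound[OF A])
        have "4 * real k ^ 3 * (\<Sum>p | prime p \<and> 2 ^ J < p \<and> p \<le> z. 1 / (real p * ln (real p)))
            \<le> 4 * real k ^ 3 * (B / real J)" by (intro mult_left_mono tail) auto
        also have "\<dots> \<le> 1" using J(3,4) by (simp add: field_simps)
        finally show "4 * real k ^ 3 * (\<Sum>p | prime p \<and> 2 ^ J < p \<and> p \<le> z. 1 / (real p * ln (real p))) \<le> 1" .
        show "real (card {u \<in> primes_upto n. u mod p = r}) \<le> \<beta> / real p" if "prime p" "p \<le> z" for p r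
        proof -
          have "real p \<le> (ln (real n))\<^sup>2" using that zu by (simp add: l_def)
          from N0[OF nN that(1) this, of r] show ?thesis by (simp add: \<beta>_def l_def mult.commute)
        qed
        show "4 * real k ^ 3 * ln (real n) \<le> real z" using p3 zl by (simp add: l_def)
        show "\<beta> \<ge> 0" using l0 by (simp add: \<beta>_def)
      qed (use n4 k x2 z1 J in auto)
      have pm: "\<alpha> ^ (k - 1) * \<alpha> = \<alpha> ^ k" using k by (intro power_minus_mult) simp
      have "\<beta> / sqrt (2 ^ J) \<le> \<alpha>"
      proof -
        \<comment> \<open>The 800 combines 200 from the bound in residue classes with 4 from the
          lower bound for the number of primes.\<close>
        have "\<beta> = 800 / \<delta> * (\<delta> * real n / (4 * l))" using \<delta> by (simp add: \<beta>_def)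
        also have "\<dots> \<le> 800 / \<delta> * \<alpha>" using al \<delta> by (intro mult_left_mono) auto
        also have "\<dots> \<le> sqrt (2 ^ J) * \<alpha>" using J(2) a0 by (intro mult_right_mono) auto
        finally show ?thesis by (simp add: pos_divide_le_eq mult.commute)
      qed
      hence "\<alpha> ^ (k - 1) * (\<beta> / sqrt (2 ^ J)) \<le> \<alpha> ^ (k - 1) * \<alpha>"
        using a0 by (intro mult_left_mono) auto
      hence t1: "\<alpha> ^ k + \<alpha> ^ (k - 1) * (\<beta> / sqrt (2 ^ J)) \<le> 2 * \<alpha> ^ k" using pm by simp
      have n3: "real (2 * n + 1) \<le> 3 * real n" using n4 by simp
      have t2: "real (2 * n + 1) * (V / ln (real x)) ^ k * exp 1 * (\<alpha> ^ k + \<alpha> ^ (k - 1) * (\<beta> / sqrt (2 ^ J)))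
          \<le> (3 * real n) * (24 * real k * V / l) ^ k * 3 * (2 * \<alpha> ^ k)"
      proof (intro mult_mono power_mono t1 n3 exp_le)
        have "V / ln (real x) \<le> V / (l / (24 * real k))"
          using V1 l0 k1 lnx x2 by (intro divide_left_mono mult_pos_pos) auto
        thus "V / ln (real x) \<le> 24 * real k * V / l" by (simp add: mult_ac)
      qed (use V1 x2 l0 a0 \<beta>_def in auto)
      have t3: "real k ^ 2 * \<alpha> ^ (k - 1) * real (2 * n + 1) \<le> \<alpha> ^ k * q"
      proof -
        have "real (2 * n + 1) * real k ^ 2 \<le> 3 * real n * real k ^ 2" using n3 by (intro mult_right_mono) auto
        also have "\<dots> = (\<delta> * real n / (4 * l)) * (12 * real k ^ 2 * l / \<delta>)" using \<delta> l0 by simp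
        also have "\<dots> \<le> \<alpha> * (12 * real k ^ 2 * l / \<delta>)" using al \<delta> l0 by (intro mult_right_mono) auto
        also have "12 * real k ^ 2 * l / \<delta> \<le> q"
          using p6 l0 unfolding q_def l_def[symmetric] by (simp add: pos_le_divide_eq)
        finally have "real (2 * n + 1) * real k ^ 2 \<le> \<alpha> * q" using a0 by simp
        hence "\<alpha> ^ (k - 1) * (real (2 * n + 1) * real k ^ 2) \<le> \<alpha> ^ (k - 1) * (\<alpha> * q)"
          using a0 by (intro mult_left_mono) auto
        also have "\<dots> = \<alpha> ^ k * q" using pm by (simp flip: mult.assoc)
        finally show ?thesis by (simp add: mult_ac)
      qed
      have t4: "\<alpha> ^ k * (real x ^ (6 * k) + real k * (real x + 1)) \<le> \<alpha> ^ k * q"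
        using K a0 by (intro mult_left_mono) auto
      define y where "y = (24 * real k * V) ^ k"
      have y1: "y \<ge> 1" unfolding y_def using kV by (intro one_le_power) auto
      have "(\<Sum>m<2 * n + 1. real (card {a \<in> A. a \<le> m \<and> m - a \<in> primes_upto n}) ^ k)
          \<le> (3 * real n) * (24 * real k * V / l) ^ k * 3 * (2 * \<alpha> ^ k) + \<alpha> ^ k * q + \<alpha> ^ k * q"
        using mom0 t2 t3 t4 by linarith
      \<comment> \<open>The factor 18 is 3 for \<open>2 * n + 1 \<le> 3 * n\<close>, times 3 for
        \<open>exp 1\<close>, times 2 for the average over tuples. The two error terms raise it to
        20, which is absorbed into the \<open>k\<close>-th power and gives 480 = 20 * 24.\<close>
      also have "(3 * real n) * (24 * real k * V / l) ^ k * 3 * (2 * \<alpha> ^ k) = \<alpha> ^ k * q * (18 * y)"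
        by (simp add: power_divide q_def y_def)
      also have "\<alpha> ^ k * q * (18 * y) + \<alpha> ^ k * q + \<alpha> ^ k * q = \<alpha> ^ k * q * (18 * y + 2)"
        by (simp add: algebra_simps)
      also have "\<dots> \<le> \<alpha> ^ k * q * (20 ^ k * y)"
      proof (rule mult_left_mono)
        have "20 * y \<le> 20 ^ k * y" using k y1 by (intro mult_right_mono self_le_power) auto
        thus "18 * y + 2 \<le> 20 ^ k * y" using y1 by linarith
      qed (use a0 q0 in auto)
      also have "\<dots> = \<alpha> ^ k * real n * ((480 * real k * V) / ln (real n)) ^ k"
      proof -
        have "20 ^ k * y = (480 * real k * V) ^ k"
          unfolding y_def by (simp add: power_mult_distrib[symmetric] mult.assoc[symmetric])
        thus ?thesis by (simp add: q_def power_divide l_def)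
      qed
      finally have mom: "(\<Sum>m<2 * n + 1. real (card {a \<in> A. a \<le> m \<and> m - a \<in> primes_upto n}) ^ k)
          \<le> real (card A) ^ k * real n * ((480 * real k * V) / ln (real n)) ^ k" by (simp add: \<alpha>_def)
      show "real (card (A + A)) \<ge> \<delta> * exp (-1) / (4 * (480 * real k * V))\<^sup>2 * real n"
        by (rule card_sumset_ge_of_moment[OF A _ k _ \<delta> _ mom])
           (use n4 kV al in \<open>auto simp: l_def \<alpha>_def\<close>)
    qed
  qed
  thus ?thesis by (simp add: eventually_sequentially)
qed

section \<open>Comparison with the claimed loss and choice of parameters\<close>

text \<open>For \<delta> near 1, \<open>L = ln (1 / \<delta>)\<close> is below 1 and the cube root
  is negative, so the exponential in the claim exceeds 1. It stays bounded because
  \<open>- ln L \<le> 1 / L\<close> makes the cube root at most \<open>L powr (- (1 / 3))\<close> in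
  absolute value, less than \<open>L powr (2 / 3)\<close> needs to compensate.\<close>

lemma exponent_bound_small:
  fixes L :: real
  assumes L: "L > 0"
  shows "- (L powr (2 / 3) * root 3 (ln L)) \<le> 1"
proof (cases "L \<ge> 1")
  case True
  hence "L powr (2 / 3) * root 3 (ln L) \<ge> 0" by (intro mult_nonneg_nonneg) auto
  thus ?thesis by simp
next
  case False
  have "- ln L \<le> 1 / L" using ln_le_minus_one[of "1 / L"] L by (simp add: ln_div)
  hence "root 3 (- ln L) \<le> root 3 (1 / L)" by simp
  also have "root 3 (1 / L) = (1 / L) powr (1 / 3)" using L by (simp add: root_powr_inverse)
  also have "\<dots> = L powr (- (1 / 3))" using L by (simp add: powr_divide powr_minus_divide)
  finally have "L powr (2 / 3) * root 3 (- ln L) \<le> L powr (2 / 3) * L powr (- (1 / 3))"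
    by (intro mult_left_mono) auto
  also have "\<dots> = L powr (1 / 3)" by (simp flip: powr_add)
  also have "\<dots> \<le> 1" using L False by (intro powr_le1) auto
  finally show ?thesis by (simp add: real_root_minus)
qed

text \<open>The proof loses only a power of \<open>L + 3\<close>, and this shows that the claimed
  loss is larger. For \<open>L \<le> exp 1\<close> the constants suffice, as
  \<open>L + 3 \<le> 6\<close>. Beyond, the cube root is at least 1,
  \<open>ln L \<le> 3 / 2 * L powr (2 / 3)\<close> and \<open>L + 3 \<le> 6 * L\<close>.\<close>

lemma polylog_loss_le:
  fixes B L :: real
  assumes L: "L > 0" and B: "B \<ge> 0"
  shows "6 powr (- B) * exp (- (3 / 2 * B)) * exp (- (3 / 2 * B * L powr (2 / 3) * root 3 (ln L)))
    \<le> (L + 3) powr (- B)"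
proof (cases "L \<le> exp 1")
  case True
  have "- (3 / 2 * B * L powr (2 / 3) * root 3 (ln L)) = 3 / 2 * B * - (L powr (2 / 3) * root 3 (ln L))" by simp
  also have "\<dots> \<le> 3 / 2 * B * 1" using exponent_bound_small[OF L] B by (intro mult_left_mono) auto
  finally have "exp (- (3 / 2 * B)) * exp (- (3 / 2 * B * L powr (2 / 3) * root 3 (ln L))) \<le> 1"
    by (simp flip: exp_add)
  hence "6 powr (- B) * (exp (- (3 / 2 * B)) * exp (- (3 / 2 * B * L powr (2 / 3) * root 3 (ln L)))) \<le> 6 powr (- B) * 1"
    by (intro mult_left_mono) auto
  also have "6 powr (- B) * 1 \<le> (L + 3) powr (- B)"
    using True exp_le L B by (simp add: powr_mono2')
  finally show ?thesis by simp
next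
  case False
  have e: "exp (1::real) \<ge> 2" using exp_ge_add_one_self[of 1] by simp
  have L2: "L \<ge> 2" using False e by linarith
  have "1 < ln L" using False L by (metis exp_less_cancel_iff exp_ln linorder_not_le)
  hence "root 3 (ln L) \<ge> 1" by simp
  hence "L powr (2 / 3) * 1 \<le> L powr (2 / 3) * root 3 (ln L)" by (intro mult_left_mono) auto
  moreover have "ln L \<le> 3 / 2 * L powr (2 / 3)"
  proof -
    have "2 / 3 * ln L = ln (L powr (2 / 3))" using L by (simp add: ln_powr)
    also have "\<dots> \<le> L powr (2 / 3)" using L ln_le_minus_one[of "L powr (2 / 3)"] by simp
    finally show ?thesis by simp
  qed
  ultimately have lnL: "ln L \<le> 3 / 2 * (L powr (2 / 3) * root 3 (ln L))" by linarith
  have "6 powr (- B) * exp (- (3 / 2 * B)) * exp (- (3 / 2 * B * L powr (2 / 3) * root 3 (ln L)))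
      \<le> 6 powr (- B) * 1 * exp (- (B * ln L))"
  proof (intro mult_mono)
    have "B * ln L \<le> B * (3 / 2 * (L powr (2 / 3) * root 3 (ln L)))" using lnL B by (intro mult_left_mono)
    thus "exp (- (3 / 2 * B * L powr (2 / 3) * root 3 (ln L))) \<le> exp (- (B * ln L))" by (simp add: mult_ac)
  qed (use B in auto)
  also have "exp (- (B * ln L)) = L powr (- B)" using L by (simp add: powr_def)
  also have "6 powr (- B) * 1 * L powr (- B) = (6 * L) powr (- B)" using L by (simp add: powr_mult)
  also have "\<dots> \<le> (L + 3) powr (- B)" using L2 B by (intro powr_mono2') auto
  finally show ?thesis .
qed

theorem theorem3p1:
  "\<exists>C\<^sub>1 C\<^sub>2 :: real. C\<^sub>1 > 0 \<and> C\<^sub>2 > 0 \<and>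
     (\<forall>\<delta>::real. 0 < \<delta> \<and> \<delta> < 1 \<longrightarrow>
       (\<exists>n\<^sub>0::nat. \<forall>n\<ge>n\<^sub>0. \<forall>A. A \<subseteq> primes_upto n \<longrightarrow>
          real (card A) \<ge> \<delta> * real (card (primes_upto n)) \<longrightarrow>
          real (card (A + A)) \<ge>
            C\<^sub>1 * \<delta> * exp (- (C\<^sub>2 * (ln (1 / \<delta>)) powr (2 / 3) * root 3 (ln (ln (1 / \<delta>))))) * real n))"
proof -
  obtain B1 where B1: "B1 > 0" "\<And>J. J \<ge> 1 \<Longrightarrow>
      (\<Prod>p\<in>primes_upto (2 ^ J). real p / (real p - 1)) \<le> exp (B1 * (1 + ln (real J)))"
    using prod_primes_upto_le by blast
  obtain B2 where B2: "B2 > 0" "\<And>J z. J \<ge> 1 \<Longrightarrow>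
      (\<Sum>p | prime p \<and> 2 ^ J < p \<and> p \<le> z. 1 / (real p * ln (real p))) \<le> B2 / real J"
    using sum_prime_tail_le by blast
  \<comment> \<open>With \<open>J = c0 * k ^ 3\<close>, the part \<open>4 * B2\<close> controls the
    tail over primes, and 24 guarantees \<open>J \<ge> 24 * k\<close>, which is used for
    \<open>800 / \<delta>\<close>.\<close>
  define c0 where "c0 = nat \<lceil>4 * B2\<rceil> + 24"
  have c0: "real c0 \<ge> 4 * B2" "c0 \<ge> 24" unfolding c0_def by linarith+
  \<comment> \<open>\<open>V\<close> is at most a constant times \<open>J powr B1\<close>, so
    \<open>k * V\<close> grows at most like \<open>k powr (1 + 3 * B1)\<close>; it enters
    squared.\<close>
  define B where "B = 2 * (1 + 3 * B1)"
  define H where "H = 1920 * exp B1 * real c0 powr B1"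
  have H0: "H > 0" using c0 by (simp add: H_def)
  have B0: "B > 0" using B1 by (simp add: B_def)
  define C1 where "C1 = exp (-1) / H\<^sup>2 * (6 powr (- B) * exp (- (3 / 2 * B)))"
  have C1: "C1 > 0" using H0 by (simp add: C1_def)
  have main: "\<exists>n\<^sub>0::nat. \<forall>n\<ge>n\<^sub>0. \<forall>A. A \<subseteq> primes_upto n \<longrightarrow>
          real (card A) \<ge> \<delta> * real (card (primes_upto n)) \<longrightarrow>
          real (card (A + A)) \<ge>
            C1 * \<delta> * exp (- (3 / 2 * B * (ln (1 / \<delta>)) powr (2 / 3) * root 3 (ln (ln (1 / \<delta>))))) * real n"
    if \<delta>: "0 < \<delta>" "\<delta> < 1" for \<delta>
  proof -
    define L where "L = ln (1 / \<delta>)"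
    have L0: "L > 0" using \<delta> by (simp add: L_def)
    have dL: "\<delta> = exp (- L)" using \<delta> by (simp add: L_def ln_div)
    \<comment> \<open>The summand 2 ensures both \<open>k \<ge> 2\<close> and
      \<open>k - 1 \<ge> L\<close>, that is, \<open>exp (- (k - 1)) \<le> \<delta>\<close>.\<close>
    define k where "k = nat \<lceil>L\<rceil> + 2"
    have k2: "k \<ge> 2" by (simp add: k_def)
    have kL: "real k - 1 \<ge> L" "real k \<le> L + 3" unfolding k_def using L0 by linarith+
    define J where "J = c0 * k ^ 3"
    have k3: "k \<le> k ^ 3" using k2 by (intro self_le_power) auto
    have J24: "24 * k \<le> J" unfolding J_def using c0 k3 by (intro mult_mono) auto
    have J1: "J \<ge> 1" using J24 k2 by linarith
    define V where "V = (\<Prod>p\<in>primes_upto (2 ^ J). real p / (real p - 1))"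
    have V1: "V \<ge> 1"
      unfolding V_def using prime_ratio_bounds(1) by (intro prod_ge_1) (auto simp: primes_upto_def)
    obtain n0 where n0: "\<And>n A. n \<ge> n0 \<Longrightarrow> A \<subseteq> primes_upto n \<Longrightarrow> real (card A) \<ge> \<delta> * real (card (primes_upto n)) \<Longrightarrow>
     real (card (A + A)) \<ge> \<delta> * exp (-1) / (4 * (480 * real k * V))\<^sup>2 * real n"
    proof -
      have "\<exists>n0. \<forall>n\<ge>n0. \<forall>A. A \<subseteq> primes_upto n \<longrightarrow> real (card A) \<ge> \<delta> * real (card (primes_upto n)) \<longrightarrow>
         real (card (A + A)) \<ge> \<delta> * exp (-1) / (4 * (480 * real k * V))\<^sup>2 * real n"
        unfolding V_def
      proof (rule eventually_card_sumset_ge[OF k2 \<delta>(1) _ _ _ J1 _ B2(2)[OF J1]])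
        show "exp (- (real k - 1)) \<le> \<delta>" using kL dL by simp
        have "2 * k \<le> 2 ^ (2 * k)" by (rule less_imp_le, rule less_exp)
        also have "\<dots> \<le> 2 ^ J" using J24 by (intro power_increasing) auto
        finally show "2 * k \<le> 2 ^ J" .
        show "800 / \<delta> \<le> sqrt (2 ^ J)"
        proof (rule real_le_rsqrt)
          have "1 / \<delta> = exp L" using \<delta> by (simp add: L_def)
          also have "\<dots> \<le> exp (real k * 1)" using kL by simp
          also have "\<dots> = exp 1 ^ k" by (rule exp_of_nat_mult)
          also have "\<dots> \<le> 4 ^ k" using exp_le by (intro power_mono) auto
          finally have "1 / \<delta> \<le> 4 ^ k" .
          \<comment> \<open>Together with \<open>1 / \<delta> \<le> 4 ^ k\<close> this gives
            \<open>2 ^ (12 * k)\<close>, whose square is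
            \<open>2 ^ (24 * k) \<le> 2 ^ J\<close>.\<close>
          moreover have "(800::real) \<le> 1024 ^ k" using k2 self_le_power[of "1024::real" k] by simp
          ultimately have "800 * (1 / \<delta>) \<le> 1024 ^ k * 4 ^ k" using \<delta> by (intro mult_mono) auto
          also have "\<dots> = (2::real) ^ (12 * k)"
            by (simp add: power_mult flip: power_mult_distrib)
          finally have "800 / \<delta> \<le> 2 ^ (12 * k)" by simp
          hence "(800 / \<delta>)\<^sup>2 \<le> (2 ^ (12 * k))\<^sup>2" using \<delta> by (intro power_mono) auto
          also have "\<dots> = 2 ^ (24 * k)" by (simp flip: power_mult)
          also have "\<dots> \<le> 2 ^ J" using J24 by (intro power_increasing) auto
          finally show "(800 / \<delta>)\<^sup>2 \<le> 2 ^ J" .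
        qed
        have "4 * real k ^ 3 * B2 = (4 * B2) * real k ^ 3" by simp
        also have "\<dots> \<le> real c0 * real k ^ 3" using c0 by (intro mult_right_mono) auto
        finally show "4 * real k ^ 3 * B2 \<le> real J" by (simp add: J_def)
      qed
      thus ?thesis using that by blast
    qed
    have "4 * (480 * real k * V) \<le> H * (L + 3) powr (1 + 3 * B1)"
    proof -
      have "V \<le> exp (B1 * (1 + ln (real J)))" unfolding V_def by (rule B1(2)[OF J1])
      also have "\<dots> = exp B1 * real J powr B1" using J1 by (simp add: powr_def algebra_simps exp_add)
      also have "real J powr B1 = real c0 powr B1 * real k powr (3 * B1)"
      proof -
        have "real J = real c0 * real k powr 3" using k2 by (simp add: J_def powr_numeral)
        thus ?thesis by (simp only: powr_mult powr_powr)
      qed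
      finally have "4 * (480 * real k * V) \<le> 4 * (480 * real k * (exp B1 * (real c0 powr B1 * real k powr (3 * B1))))"
        by (intro mult_left_mono) auto
      also have "\<dots> = H * (real k powr 1 * real k powr (3 * B1))" using k2 by (simp add: H_def)
      also have "\<dots> = H * real k powr (1 + 3 * B1)" by (simp only: powr_add)
      also have "\<dots> \<le> H * (L + 3) powr (1 + 3 * B1)"
        using H0 kL k2 B1 by (intro mult_left_mono powr_mono2) auto
      finally show ?thesis .
    qed
    hence "(4 * (480 * real k * V))\<^sup>2 \<le> (H * (L + 3) powr (1 + 3 * B1))\<^sup>2"
      using V1 by (intro power_mono) auto
    also have "\<dots> = H\<^sup>2 * (L + 3) powr B"
      using L0 by (simp add: power_mult_distrib B_def powr_power mult.commute)
    finally have sq: "(4 * (480 * real k * V))\<^sup>2 \<le> H\<^sup>2 * (L + 3) powr B" .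
    have sq0: "(4 * (480 * real k * V))\<^sup>2 > 0" using k2 V1 by simp
    have fin: "C1 * \<delta> * exp (- (3 / 2 * B * L powr (2 / 3) * root 3 (ln L)))
        \<le> \<delta> * exp (-1) / (4 * (480 * real k * V))\<^sup>2"
    proof -
      have "C1 * \<delta> * exp (- (3 / 2 * B * L powr (2 / 3) * root 3 (ln L)))
        = \<delta> * exp (-1) / H\<^sup>2 * (6 powr (- B) * exp (- (3 / 2 * B)) * exp (- (3 / 2 * B * L powr (2 / 3) * root 3 (ln L))))"
        by (simp add: C1_def)
      also have "\<dots> \<le> \<delta> * exp (-1) / H\<^sup>2 * (L + 3) powr (- B)"
        using L0 B0 \<delta> by (intro mult_left_mono polylog_loss_le) auto
      also have "\<dots> = \<delta> * exp (-1) / (H\<^sup>2 * (L + 3) powr B)"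
        by (simp add: powr_minus_divide)
      also have "\<dots> \<le> \<delta> * exp (-1) / (4 * (480 * real k * V))\<^sup>2"
        using sq sq0 \<delta> by (intro divide_left_mono mult_pos_pos) auto
      finally show ?thesis .
    qed
    show ?thesis
    proof (intro exI[of _ n0] allI impI)
      fix n A assume "n0 \<le> n" "A \<subseteq> primes_upto n" "real (card A) \<ge> \<delta> * real (card (primes_upto n))"
      from n0[OF this] mult_right_mono[OF fin, of "real n"]
      show "real (card (A + A)) \<ge>
            C1 * \<delta> * exp (- (3 / 2 * B * (ln (1 / \<delta>)) powr (2 / 3) * root 3 (ln (ln (1 / \<delta>))))) * real n"
        unfolding L_def by linarith
    qed
  qed
  show ?thesis
    using main C1 B0 by (intro exI[of _ C1] exI[of _ "3 / 2 * B"]) auto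
qed

end
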